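(* Let $G$ be a Gromov-hyperbolic group with Cayley graph $\Gamma=\Gamma(G,S)$, and let $\rho$ satisfy (i)–(iii) of the context. Fix a vertex $o\in\Gamma$, a point $\xi\in\partial G$, and a sequence of vertices $x_n\in\Gamma$ such that $x_n\to\xi$. Then for $\mathbb{P}$-a.e. $\omega\in\Omega$ the sequence of $\omega$-geodesics $[o,x_n]_\omega$ from $o$ to $x_n$ converges, up to passing to a subsequence, to an $\omega$-geodesic ray $[o,\xi)_\omega$ starting at $o$ and having direction $\xi$.
   Context: $G$ is a finitely generated (Gromov-)hyperbolic group, $S$ a finite symmetric generating set, $\Gamma=\Gamma(G,S)$ the undirected Cayley graph (vertex set $G$; an edge between $g$ and $h$ iff $g^{-1}h\in S$) with edge set $E$, and $\partial G$ is the Gromov boundary. First passage percolation: $\rho$ is a probability measure such that (i) its support is contained in $[0,\infty)$; (ii) it has no atoms; (iii) $\int e^{ax^2}\,d\rho(x)<\infty$ for some $a>0$. $\Omega=[0,\infty)^E$ carries $\mathbb{P}=\rho^{\otimes E}$. For an edge path $\gamma$, $\ell_\omega(\gamma)=\sum_{e\in\gamma}\omega(e)$, and $d_\omega(x,y)=\inf_\gamma\ell_\omega(\gamma)$ over edge paths from $x$ to $y$. The $\omega$-geodesic $[x,y]_\omega$ is the path attaining $d_\omega(x,y)$ (for a.e. $\omega$ it exists and is unique for every pair $x,y$). An $\omega$-geodesic ray is a semi-infinite path all of whose finite subpaths are $\omega$-geodesics. Convergence of paths starting at $o$ to a ray means that every finite initial segment of the ray is an initial segment of all but finitely many of the paths.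 A path $\sigma$ accumulates on $\eta\in\partial G$ if there are $v_n\in\sigma$ with $v_n\to\eta$ in the Gromov compactification $\Gamma\cup\partial G$. An $\omega$-geodesic ray has direction $\xi$ if $\xi$ is an accumulation point of it in $\partial G$ and is its only accumulation point in $\partial G$. *)

theory Defs
  imports "HOL-Probability.Probability" "HOL-Algebra.Generated_Groups" "HOL-Library.Sublist"
begin

text \<open>A graph is given by a vertex set \<open>V\<close> and a set \<open>E\<close> of edges, an edge being the set of
  its endpoints (a singleton if it is a loop). An edge path is given by its nonempty list of
  vertices, so \<open>[x]\<close> is the constant path at \<open>x\<close>; there are no parallel edges.\<close>

definition path_edges :: "'a list \<Rightarrow> 'a set list" where
  "path_edges \<gamma> = map (\<lambda>(u, v). {u, v}) (zip \<gamma> (tl \<gamma>))"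

definition edge_path :: "'a set \<Rightarrow> 'a set set \<Rightarrow> 'a list \<Rightarrow> bool" where
  "edge_path V E \<gamma> \<longleftrightarrow> \<gamma> \<noteq> [] \<and> set \<gamma> \<subseteq> V \<and> set (path_edges \<gamma>) \<subseteq> E"

definition edge_paths_between :: "'a set \<Rightarrow> 'a set set \<Rightarrow> 'a \<Rightarrow> 'a \<Rightarrow> 'a list set" where
  "edge_paths_between V E x y = {\<gamma>. edge_path V E \<gamma> \<and> hd \<gamma> = x \<and> last \<gamma> = y}"

definition graph_dist :: "'a set \<Rightarrow> 'a set set \<Rightarrow> 'a \<Rightarrow> 'a \<Rightarrow> real" where
  "graph_dist V E x y =
     real (INF \<gamma>\<in>edge_paths_between V E x y. length (path_edges \<gamma>))"

definition gromov_product :: "('a \<Rightarrow> 'a \<Rightarrow> real) \<Rightarrow> 'a \<Rightarrow> 'a \<Rightarrow> 'a \<Rightarrow> real" where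
  "gromov_product d w x y = (d x w + d y w - d x y) / 2"

definition gromov_hyperbolic :: "'a set \<Rightarrow> ('a \<Rightarrow> 'a \<Rightarrow> real) \<Rightarrow> bool" where
  "gromov_hyperbolic X d \<longleftrightarrow> (\<exists>\<delta>\<ge>0. \<forall>w\<in>X. \<forall>x\<in>X. \<forall>y\<in>X. \<forall>z\<in>X.
     gromov_product d w x z \<ge> min (gromov_product d w x y) (gromov_product d w y z) - \<delta>)"

definition gromov_sequences :: "'a set \<Rightarrow> ('a \<Rightarrow> 'a \<Rightarrow> real) \<Rightarrow> 'a \<Rightarrow> (nat \<Rightarrow> 'a) set" where
  "gromov_sequences X d w = {x. range x \<subseteq> X \<and>
     filterlim (\<lambda>(i, j). gromov_product d w (x i) (x j)) at_top (sequentially \<times>\<^sub>F sequentially)}"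

definition gromov_equivalence ::
    "'a set \<Rightarrow> ('a \<Rightarrow> 'a \<Rightarrow> real) \<Rightarrow> 'a \<Rightarrow> ((nat \<Rightarrow> 'a) \<times> (nat \<Rightarrow> 'a)) set" where
  "gromov_equivalence X d w = {(x, y). x \<in> gromov_sequences X d w \<and> y \<in> gromov_sequences X d w \<and>
     filterlim (\<lambda>(i, j). gromov_product d w (x i) (y j)) at_top (sequentially \<times>\<^sub>F sequentially)}"

text \<open>If \<open>X\<close> is hyperbolic, then \<open>gromov_equivalence X d w\<close> is an equivalence relation that does
  not depend on the base point \<open>w \<in> X\<close>.\<close>

definition gromov_boundary ::
    "'a set \<Rightarrow> ('a \<Rightarrow> 'a \<Rightarrow> real) \<Rightarrow> 'a \<Rightarrow> (nat \<Rightarrow> 'a) set set" where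
  "gromov_boundary X d w = gromov_sequences X d w // gromov_equivalence X d w"

text \<open>A sequence of points of \<open>X\<close> converges to a boundary point in the Gromov compactification
  iff it is one of the sequences representing that boundary point.\<close>

definition converges_to_boundary ::
    "'a set \<Rightarrow> ('a \<Rightarrow> 'a \<Rightarrow> real) \<Rightarrow> 'a \<Rightarrow> (nat \<Rightarrow> 'a) \<Rightarrow> (nat \<Rightarrow> 'a) set \<Rightarrow> bool" where
  "converges_to_boundary X d w x \<xi> \<longleftrightarrow> \<xi> \<in> gromov_boundary X d w \<and> x \<in> \<xi>"

definition accumulates_on ::
    "'a set \<Rightarrow> ('a \<Rightarrow> 'a \<Rightarrow> real) \<Rightarrow> 'a \<Rightarrow> (nat \<Rightarrow> 'a) \<Rightarrow> (nat \<Rightarrow> 'a) set \<Rightarrow> bool" where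
  "accumulates_on X d w r \<eta> \<longleftrightarrow>
     (\<exists>v. (\<forall>n. v n \<in> range r) \<and> converges_to_boundary X d w v \<eta>)"

definition has_direction ::
    "'a set \<Rightarrow> ('a \<Rightarrow> 'a \<Rightarrow> real) \<Rightarrow> 'a \<Rightarrow> (nat \<Rightarrow> 'a) \<Rightarrow> (nat \<Rightarrow> 'a) set \<Rightarrow> bool" where
  "has_direction X d w r \<xi> \<longleftrightarrow> accumulates_on X d w r \<xi> \<and>
     (\<forall>\<eta>\<in>gromov_boundary X d w. accumulates_on X d w r \<eta> \<longrightarrow> \<eta> = \<xi>)"

definition cayley_edges :: "('a, 'b) monoid_scheme \<Rightarrow> 'a set \<Rightarrow> 'a set set" where
  "cayley_edges G S =
     {{g, h} | g h. g \<in> carrier G \<and> h \<in> carrier G \<and> m_inv G g \<otimes>\<^bsub>G\<^esub> h \<in> S}"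

definition finite_symmetric_generating_set :: "('a, 'b) monoid_scheme \<Rightarrow> 'a set \<Rightarrow> bool" where
  "finite_symmetric_generating_set G S \<longleftrightarrow> finite S \<and> S \<subseteq> carrier G \<and>
     (\<forall>s\<in>S. m_inv G s \<in> S) \<and> generate G S = carrier G"

abbreviation cayley_dist :: "('a, 'b) monoid_scheme \<Rightarrow> 'a set \<Rightarrow> 'a \<Rightarrow> 'a \<Rightarrow> real" where
  "cayley_dist G S \<equiv> graph_dist (carrier G) (cayley_edges G S)"

definition measure_support :: "'a::topological_space measure \<Rightarrow> 'a set" where
  "measure_support M = {x. \<forall>U. open U \<and> x \<in> U \<longrightarrow> emeasure M U \<noteq> 0}"

definition admissible_weight_distribution :: "real measure \<Rightarrow> bool" where
  "admissible_weight_distribution \<rho> \<longleftrightarrow> prob_space \<rho> \<and> sets \<rho> = sets borel \<and>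
     measure_support \<rho> \<subseteq> {0..} \<and>
     (\<forall>x. emeasure \<rho> {x} = 0) \<and>
     (\<exists>a>0. (\<integral>\<^sup>+ x. ennreal (exp (a * x\<^sup>2)) \<partial>\<rho>) < \<infinity>)"

text \<open>The underlying set is the set of functions \<open>E \<rightarrow> [0,\<infinity>)\<close>. If the support
  of \<open>\<rho>\<close> is contained in \<open>[0,\<infinity>)\<close>, the restriction of \<open>\<rho>\<close> is a probability measure.\<close>

definition fpp_measure :: "'e set \<Rightarrow> real measure \<Rightarrow> ('e \<Rightarrow> real) measure" where
  "fpp_measure E \<rho> = (\<Pi>\<^sub>M e\<in>E. restrict_space \<rho> {0..})"

definition fpp_length :: "('a set \<Rightarrow> real) \<Rightarrow> 'a list \<Rightarrow> real" where
  "fpp_length \<omega> \<gamma> = (\<Sum>e\<leftarrow>path_edges \<gamma>. \<omega> e)"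

definition fpp_dist ::
    "'a set \<Rightarrow> 'a set set \<Rightarrow> ('a set \<Rightarrow> real) \<Rightarrow> 'a \<Rightarrow> 'a \<Rightarrow> real" where
  "fpp_dist V E \<omega> x y = (INF \<gamma>\<in>edge_paths_between V E x y. fpp_length \<omega> \<gamma>)"

definition is_fpp_geodesic ::
    "'a set \<Rightarrow> 'a set set \<Rightarrow> ('a set \<Rightarrow> real) \<Rightarrow> 'a \<Rightarrow> 'a \<Rightarrow> 'a list \<Rightarrow> bool" where
  "is_fpp_geodesic V E \<omega> x y \<gamma> \<longleftrightarrow>
     \<gamma> \<in> edge_paths_between V E x y \<and> fpp_length \<omega> \<gamma> = fpp_dist V E \<omega> x y"

text \<open>Meaningful only when the geodesic exists and is unique, which for \<open>fpp_measure E \<rho>\<close> with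
  admissible \<open>\<rho>\<close> holds almost surely, simultaneously for all \<open>x\<close> and \<open>y\<close>.\<close>

definition fpp_geodesic ::
    "'a set \<Rightarrow> 'a set set \<Rightarrow> ('a set \<Rightarrow> real) \<Rightarrow> 'a \<Rightarrow> 'a \<Rightarrow> 'a list" where
  "fpp_geodesic V E \<omega> x y = (THE \<gamma>. is_fpp_geodesic V E \<omega> x y \<gamma>)"

definition is_fpp_geodesic_ray ::
    "'a set \<Rightarrow> 'a set set \<Rightarrow> ('a set \<Rightarrow> real) \<Rightarrow> (nat \<Rightarrow> 'a) \<Rightarrow> bool" where
  "is_fpp_geodesic_ray V E \<omega> r \<longleftrightarrow>
     (\<forall>i j. i \<le> j \<longrightarrow> is_fpp_geodesic V E \<omega> (r i) (r j) (map r [i..<Suc j]))"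

definition paths_converge_to_ray :: "(nat \<Rightarrow> 'a list) \<Rightarrow> (nat \<Rightarrow> 'a) \<Rightarrow> bool" where
  "paths_converge_to_ray \<gamma> r \<longleftrightarrow>
     (\<forall>k. eventually (\<lambda>n. prefix (map r [0..<Suc k]) (\<gamma> n)) sequentially)"

end

theory Submission
  imports Defs "HOL-Real_Asymp.Real_Asymp"
begin

text \<open>Throughout, \<open>w\<close> is the identity element, \<open>d\<close> the word metric, \<open>(a|b)\<close> the Gromov product at
  \<open>w\<close>, and \<open>d\<^sub>\<omega>\<close> the first passage distance.

  The geodesics from \<open>p\<close> to \<open>x n\<close> are simple paths in a locally finite graph, and their lengths tend
  to infinity. So a subsequence converges to a ray \<open>r\<close> (\<open>paths_have_limit_ray\<close>), which is geodesic
  because its initial segments are initial segments of geodesics. The work lies in the direction of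
  \<open>r\<close>: it has to be shown that \<open>(r k|x n)\<close> tends to infinity with \<open>k\<close> and \<open>n\<close>.

  This rests on two linear bounds, which hold almost surely up to finitely many exceptions:
  \<^item> \<open>d\<^sub>\<omega>(w, v) \<le> K d(w, v)\<close> for vertices \<open>v\<close> (\<open>AE_linear_upper_bound\<close>);
  \<^item> a simple path with \<open>n\<close> edges that starts within distance \<open>n\<close> of \<open>w\<close> has \<open>\<omega>\<close>-length at least
    \<open>\<epsilon> n\<close> (\<open>AE_linear_lower_bound\<close>).

  The number of vertices, respectively paths, at scale \<open>n\<close> grows at most exponentially. By Chernoff's
  inequality the probability that one of them violates its bound decays exponentially, at a rate
  that becomes arbitrarily large as \<open>K\<close> grows, respectively as \<open>\<epsilon>\<close> shrinks. This uses
  an exponential moment of the weights for \<open>K\<close>, and the absence of an atom at 0 for \<open>\<epsilon>\<close>. The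
  Borel--Cantelli lemma concludes.

  For such weights, let \<open>\<gamma>\<close> be a geodesic that stays at distance at least \<open>R\<close> from \<open>w\<close>, for large \<open>R\<close>,
  let \<open>u\<close> be its vertex closest to \<open>w\<close>, and let \<open>v\<close> be a vertex of \<open>\<gamma>\<close> that is \<open>n\<close> edges away from \<open>u\<close>
  along \<open>\<gamma>\<close>. Then \<open>n \<le> \<Lambda> d(w, v)\<close> for a suitable constant \<open>\<Lambda>\<close>: otherwise the segment between them
  is long enough for the lower bound \<open>\<epsilon> n\<close>, but its \<open>\<omega>\<close>-length is at most
  \<open>d\<^sub>\<omega>(w, u) + d\<^sub>\<omega>(w, v) \<le> 2 K d(w, v)\<close>. So \<open>\<gamma>\<close> escapes from \<open>w\<close> at linear speed on both sides of \<open>u\<close>.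
  Adjacent vertices at distance at least \<open>s\<close> from \<open>w\<close> have Gromov product at least \<open>s - 1/2\<close>, and by the
  four-point condition chaining \<open>n\<close> steps costs only about \<open>\<delta> log n\<close>, which linear escape outweighs.
  Hence the endpoints of \<open>\<gamma>\<close> have Gromov product at least \<open>R/2 - B\<close> (\<open>gp_far_path\<close>,
  \<open>gp_far_geodesic\<close>). This takes the place of the Morse lemma.

  Now let \<open>\<gamma>\<close> be the part after \<open>r k\<close> of a geodesic from \<open>p\<close> to \<open>x n\<close> that follows \<open>r\<close> up to \<open>r k\<close>.
  All its vertices satisfy \<open>d\<^sub>\<omega>(p, v) \<ge> \<epsilon> k\<close>, while \<open>d\<^sub>\<omega>(p, v)\<close> is bounded on the finite ball of radius
  \<open>R\<close> around \<open>w\<close>. For large \<open>k\<close> it therefore avoids this ball, and \<open>(r k|x n) \<ge> R/2 - B\<close>.\<close>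

section \<open>Edge paths\<close>

lemma path_edges_simps [simp]:
  "path_edges [] = []"
  "path_edges [u] = []"
  "path_edges (u # v # \<gamma>) = {u, v} # path_edges (v # \<gamma>)"
  by (simp_all add: path_edges_def)

lemma length_path_edges [simp]: "length (path_edges \<gamma>) = length \<gamma> - 1"
  by (simp add: path_edges_def)

lemma path_edges_append: "path_edges (xs @ v # ys) = path_edges (xs @ [v]) @ path_edges (v # ys)"
  by (induction xs rule: induct_list012) auto

lemma path_edges_rev: "path_edges (rev \<gamma>) = rev (path_edges \<gamma>)"
proof (induction \<gamma> rule: induct_list012)
  case (3 u v \<gamma>)
  have "path_edges (rev (u # v # \<gamma>)) = path_edges (rev \<gamma> @ [v]) @ path_edges [v, u]"
    using path_edges_append[of "rev \<gamma>" v "[u]"] by simp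
  then show ?case using 3 by (simp add: insert_commute)
qed auto

lemma split_at_nth:
  assumes "i < length \<gamma>"
  shows "\<gamma> = take i \<gamma> @ \<gamma> ! i # drop (Suc i) \<gamma>" "take (Suc i) \<gamma> = take i \<gamma> @ [\<gamma> ! i]"
    "drop i \<gamma> = \<gamma> ! i # drop (Suc i) \<gamma>"
  using id_take_nth_drop[OF assms] take_Suc_conv_app_nth[OF assms] Cons_nth_drop_Suc[OF assms]
  by simp_all

lemma edge_path_append:
  "edge_path V E (xs @ v # ys) \<longleftrightarrow> edge_path V E (xs @ [v]) \<and> edge_path V E (v # ys)"
  unfolding edge_path_def path_edges_append[of xs v ys] by auto

lemma edge_path_rev [simp]: "edge_path V E (rev \<gamma>) \<longleftrightarrow> edge_path V E \<gamma>"
  by (auto simp: edge_path_def path_edges_rev)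

lemma fpp_length_append:
  "fpp_length \<omega> (xs @ v # ys) = fpp_length \<omega> (xs @ [v]) + fpp_length \<omega> (v # ys)"
  unfolding fpp_length_def path_edges_append[of xs v ys] by simp

lemma fpp_length_rev [simp]: "fpp_length \<omega> (rev \<gamma>) = fpp_length \<omega> \<gamma>"
  by (simp add: fpp_length_def path_edges_rev flip: rev_map)

lemma fpp_length_simps [simp]:
  "fpp_length \<omega> [] = 0" "fpp_length \<omega> [u] = 0"
  "fpp_length \<omega> (u # v # \<gamma>) = \<omega> {u, v} + fpp_length \<omega> (v # \<gamma>)"
  by (simp_all add: fpp_length_def)

lemma fpp_length_split:
  assumes "i < length \<gamma>"
  shows "fpp_length \<omega> \<gamma> = fpp_length \<omega> (take (Suc i) \<gamma>) + fpp_length \<omega> (drop i \<gamma>)"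
  using fpp_length_append[of \<omega> "take i \<gamma>" "\<gamma> ! i" "drop (Suc i) \<gamma>"]
  by (simp add: split_at_nth[OF assms, symmetric])

lemma edge_path_split:
  assumes "i < length \<gamma>"
  shows "edge_path V E \<gamma> \<longleftrightarrow> edge_path V E (take (Suc i) \<gamma>) \<and> edge_path V E (drop i \<gamma>)"
  using edge_path_append[of V E "take i \<gamma>" "\<gamma> ! i" "drop (Suc i) \<gamma>"]
  by (simp add: split_at_nth[OF assms, symmetric])

lemma edge_path_adjacent:
  assumes "edge_path V E \<gamma>" "Suc i < length \<gamma>"
  shows "{\<gamma> ! i, \<gamma> ! Suc i} \<in> E"
proof -
  have "edge_path V E (drop i \<gamma>)" using edge_path_split[of i \<gamma> V E] assms by simp
  moreover have "drop i \<gamma> = \<gamma> ! i # \<gamma> ! Suc i # drop (Suc (Suc i)) \<gamma>"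
    using assms by (simp add: Cons_nth_drop_Suc)
  ultimately show ?thesis by (simp add: edge_path_def)
qed

lemma edge_paths_between_rev:
  "\<gamma> \<in> edge_paths_between V E x y \<Longrightarrow> rev \<gamma> \<in> edge_paths_between V E y x"
  by (auto simp: edge_paths_between_def edge_path_def hd_rev last_rev path_edges_rev)

lemma edge_paths_between_take:
  "\<gamma> \<in> edge_paths_between V E x y \<Longrightarrow> i < length \<gamma> \<Longrightarrow>
    take (Suc i) \<gamma> \<in> edge_paths_between V E x (\<gamma> ! i)"
  using edge_path_split[of i \<gamma> V E]
  by (cases \<gamma>) (auto simp: edge_paths_between_def last_conv_nth)

lemma edge_paths_between_drop:
  "\<gamma> \<in> edge_paths_between V E x y \<Longrightarrow> i < length \<gamma> \<Longrightarrow>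
    drop i \<gamma> \<in> edge_paths_between V E (\<gamma> ! i) y"
  using edge_path_split[of i \<gamma> V E] by (auto simp: edge_paths_between_def hd_drop_conv_nth)

text \<open>The length of the concatenation is recorded for all weights at once, because it is used both
  for the random weights and for the word metric.\<close>
lemma edge_paths_between_join:
  assumes "\<gamma> \<in> edge_paths_between V E x y" "\<gamma>' \<in> edge_paths_between V E y z"
  obtains \<kappa> where "\<kappa> \<in> edge_paths_between V E x z"
    "\<And>\<omega>. fpp_length \<omega> \<kappa> = fpp_length \<omega> \<gamma> + fpp_length \<omega> \<gamma>'"
proof -
  obtain xs where xs: "\<gamma> = xs @ [y]"
    using assms(1) by (auto simp: edge_paths_between_def edge_path_def) (metis append_butlast_last_id)
  obtain ys where ys: "\<gamma>' = y # ys"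
    using assms(2) by (auto simp: edge_paths_between_def edge_path_def) (metis list.collapse)
  have "xs @ y # ys \<in> edge_paths_between V E x z"
    using assms edge_path_append[of V E xs y ys]
    by (auto simp: xs ys edge_paths_between_def hd_append split: if_splits)
  then show thesis
    by (rule that) (use fpp_length_append[of _ xs y ys] in \<open>simp add: xs ys\<close>)
qed

lemma edge_paths_between_single: "x \<in> V \<Longrightarrow> [x] \<in> edge_paths_between V E x x"
  by (simp add: edge_paths_between_def edge_path_def)

lemma edge_paths_between_in_V:
  "\<gamma> \<in> edge_paths_between V E x y \<Longrightarrow> x \<in> V \<and> y \<in> V \<and> set \<gamma> \<subseteq> V \<and> \<gamma> \<noteq> []"
  by (auto simp: edge_paths_between_def edge_path_def)

lemma endpoints_in_path_edge: "e \<in> set (path_edges \<gamma>) \<Longrightarrow> e \<subseteq> set \<gamma>"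
  by (induction \<gamma> rule: induct_list012) auto

lemma distinct_path_edges: "distinct \<gamma> \<Longrightarrow> distinct (path_edges \<gamma>)"
  by (induction \<gamma> rule: induct_list012) (auto dest: endpoints_in_path_edge)

text \<open>The first edge of a simple path is the only one that contains the initial vertex. Hence the
  edge set determines the second vertex, and inductively the whole path.\<close>

lemma simple_path_eqI:
  assumes "distinct \<gamma>" "distinct \<gamma>'" "\<gamma> \<noteq> []" "\<gamma>' \<noteq> []" "hd \<gamma> = hd \<gamma>'"
    "set (path_edges \<gamma>) = set (path_edges \<gamma>')"
  shows "\<gamma> = \<gamma>'"
  using assms
proof (induction \<gamma> arbitrary: \<gamma>' rule: induct_list012)
  case (2 u)
  then have "path_edges \<gamma>' = []" by simp
  then have "length \<gamma>' = 1"
    using length_path_edges[of \<gamma>'] \<open>\<gamma>' \<noteq> []\<close> by (cases \<gamma>') auto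
  then show ?case using 2 by (cases \<gamma>') auto
next
  case (3 u v \<gamma>)
  have "path_edges \<gamma>' \<noteq> []" using 3(8) by force
  then obtain v' \<kappa> where \<gamma>': "\<gamma>' = u # v' # \<kappa>"
    using 3(6,7) by (cases \<gamma>'; cases "tl \<gamma>'") auto
  have n: "u \<notin> e" if "e \<in> set (path_edges (v # \<gamma>)) \<union> set (path_edges (v' # \<kappa>))" for e
    using that 3(3,4) endpoints_in_path_edge by (fastforce simp: \<gamma>')
  have "{u, v'} \<in> set (path_edges (u # v # \<gamma>))" unfolding 3(8) by (simp add: \<gamma>')
  then have v: "v' = v" using n by (auto simp: doubleton_eq_iff)
  have "set (path_edges (v # \<gamma>)) = set (path_edges (v' # \<kappa>))"
    using 3(8) n unfolding \<gamma>' v by (auto simp: insert_eq_iff)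
  then have "v # \<gamma> = v' # \<kappa>" using 3 by (intro 3(2)) (auto simp: \<gamma>' v)
  then show ?case by (simp add: \<gamma>')
qed simp

text \<open>Cutting out closed subpaths until none is left makes a path simple, and this can only decrease
  its length, for all nonnegative weights at once.\<close>

lemma simple_subpath:
  assumes "\<gamma> \<in> edge_paths_between V E x y"
  shows "\<exists>\<gamma>'\<in>edge_paths_between V E x y. distinct \<gamma>' \<and>
    (\<forall>\<omega>. (\<forall>e\<in>E. 0 \<le> \<omega> e) \<longrightarrow> fpp_length \<omega> \<gamma>' \<le> fpp_length \<omega> \<gamma>)"
  using assms
proof (induction \<gamma> rule: length_induct)
    case (1 \<gamma>)
    show ?case
    proof (cases "distinct \<gamma>")
      case False
      then obtain xs v ys zs where \<gamma>: "\<gamma> = xs @ v # ys @ v # zs"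
        using not_distinct_decomp[of \<gamma>] by auto
      have p: "edge_path V E (xs @ [v])" "edge_path V E ((v # ys) @ [v])" "edge_path V E (v # zs)"
        using 1(2) edge_path_append[of V E xs v "ys @ v # zs"] edge_path_append[of V E "v # ys" v zs]
        by (auto simp: edge_paths_between_def \<gamma>)
      have "edge_path V E (xs @ v # zs)" using edge_path_append[of V E xs v zs] p by simp
      then have "xs @ v # zs \<in> edge_paths_between V E x y"
        using 1(2) by (auto simp: edge_paths_between_def \<gamma> hd_append)
      moreover have "length (xs @ v # zs) < length \<gamma>" by (simp add: \<gamma>)
      ultimately obtain \<gamma>' where \<gamma>': "\<gamma>' \<in> edge_paths_between V E x y" "distinct \<gamma>'"
          "\<forall>\<omega>. (\<forall>e\<in>E. 0 \<le> \<omega> e) \<longrightarrow> fpp_length \<omega> \<gamma>' \<le> fpp_length \<omega> (xs @ v # zs)"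
        using 1(1) by blast
      have "fpp_length \<omega> (xs @ v # zs) \<le> fpp_length \<omega> \<gamma>" if "\<forall>e\<in>E. 0 \<le> \<omega> e" for \<omega>
      proof -
        have "0 \<le> fpp_length \<omega> ((v # ys) @ [v])"
          using p(2) that unfolding fpp_length_def edge_path_def by (intro sum_list_nonneg) auto
        then show ?thesis
          using fpp_length_append[of \<omega> xs v "ys @ v # zs"] fpp_length_append[of \<omega> "v # ys" v zs]
            fpp_length_append[of \<omega> xs v zs] by (simp add: \<gamma>)
      qed
      then show ?thesis using \<gamma>' by (meson order_trans)
    qed (use 1 in blast)
  qed

section \<open>First passage distances\<close>

locale connected_graph =
  fixes V :: "'a set" and E :: "'a set set"
  assumes connected: "x \<in> V \<Longrightarrow> y \<in> V \<Longrightarrow> edge_paths_between V E x y \<noteq> {}"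

locale weighted_graph = connected_graph V E for V :: "'a set" and E +
  fixes \<omega> :: "'a set \<Rightarrow> real"
  assumes nonneg: "e \<in> E \<Longrightarrow> 0 \<le> \<omega> e"
begin

lemma length_nonneg: "edge_path V E \<gamma> \<Longrightarrow> 0 \<le> fpp_length \<omega> \<gamma>"
  unfolding fpp_length_def edge_path_def by (intro sum_list_nonneg) (auto intro: nonneg)

lemma dist_le_length: "\<gamma> \<in> edge_paths_between V E x y \<Longrightarrow> fpp_dist V E \<omega> x y \<le> fpp_length \<omega> \<gamma>"
  unfolding fpp_dist_def
  by (intro cINF_lower bdd_belowI[of _ 0]) (auto simp: edge_paths_between_def intro: length_nonneg)

lemma dist_greatest:
  assumes "x \<in> V" "y \<in> V" "\<And>\<gamma>. \<gamma> \<in> edge_paths_between V E x y \<Longrightarrow> c \<le> fpp_length \<omega> \<gamma>"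
  shows "c \<le> fpp_dist V E \<omega> x y"
  unfolding fpp_dist_def using assms connected by (intro cINF_greatest) auto

lemma dist_nonneg: "x \<in> V \<Longrightarrow> y \<in> V \<Longrightarrow> 0 \<le> fpp_dist V E \<omega> x y"
  by (intro dist_greatest) (auto simp: edge_paths_between_def intro: length_nonneg)

lemma dist_self: "x \<in> V \<Longrightarrow> fpp_dist V E \<omega> x x = 0"
  using dist_le_length[OF edge_paths_between_single, of x] dist_nonneg[of x x] by simp

lemma dist_sym: "x \<in> V \<Longrightarrow> y \<in> V \<Longrightarrow> fpp_dist V E \<omega> x y = fpp_dist V E \<omega> y x"
  by (intro antisym dist_greatest) (use edge_paths_between_rev dist_le_length in fastforce)+

lemma dist_triangle:
  assumes "x \<in> V" "y \<in> V" "z \<in> V"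
  shows "fpp_dist V E \<omega> x z \<le> fpp_dist V E \<omega> x y + fpp_dist V E \<omega> y z"
proof -
  have *: "fpp_dist V E \<omega> x z \<le> fpp_length \<omega> \<gamma> + fpp_length \<omega> \<gamma>'"
    if "\<gamma> \<in> edge_paths_between V E x y" "\<gamma>' \<in> edge_paths_between V E y z" for \<gamma> \<gamma>'
    using that by (metis dist_le_length edge_paths_between_join)
  have "fpp_dist V E \<omega> x z - fpp_length \<omega> \<gamma> \<le> fpp_dist V E \<omega> y z"
    if "\<gamma> \<in> edge_paths_between V E x y" for \<gamma>
    using assms *[OF that] by (intro dist_greatest) (auto simp: algebra_simps)
  then have "fpp_dist V E \<omega> x z - fpp_dist V E \<omega> y z \<le> fpp_dist V E \<omega> x y"
    using assms by (intro dist_greatest) (auto simp: algebra_simps)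
  then show ?thesis by simp
qed

text \<open>The two parts have total length \<open>d\<^sub>\<omega>(x, y)\<close>, so by the triangle inequality neither of them can
  be longer than the distance of its endpoints.\<close>
lemma geodesic_split:
  assumes "is_fpp_geodesic V E \<omega> x y \<gamma>" "i < length \<gamma>"
  shows "is_fpp_geodesic V E \<omega> x (\<gamma> ! i) (take (Suc i) \<gamma>)"
    and "is_fpp_geodesic V E \<omega> (\<gamma> ! i) y (drop i \<gamma>)"
proof -
  have \<gamma>: "\<gamma> \<in> edge_paths_between V E x y" "fpp_length \<omega> \<gamma> = fpp_dist V E \<omega> x y"
    using assms by (auto simp: is_fpp_geodesic_def)
  note t = edge_paths_between_take[OF \<gamma>(1) assms(2)] and d = edge_paths_between_drop[OF \<gamma>(1) assms(2)]
  have "fpp_dist V E \<omega> x y \<le> fpp_dist V E \<omega> x (\<gamma> ! i) + fpp_dist V E \<omega> (\<gamma> ! i) y"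
    using edge_paths_between_in_V[OF \<gamma>(1)] edge_paths_between_in_V[OF t] by (intro dist_triangle) auto
  then show "is_fpp_geodesic V E \<omega> x (\<gamma> ! i) (take (Suc i) \<gamma>)"
    "is_fpp_geodesic V E \<omega> (\<gamma> ! i) y (drop i \<gamma>)"
    using dist_le_length[OF t] dist_le_length[OF d] \<gamma>(2) fpp_length_split[OF assms(2), of \<omega>] t d
    by (auto simp: is_fpp_geodesic_def)
qed

lemma geodesic_segment:
  assumes "is_fpp_geodesic V E \<omega> x y \<gamma>" "i \<le> j" "j < length \<gamma>"
  shows "is_fpp_geodesic V E \<omega> (\<gamma> ! i) (\<gamma> ! j) (drop i (take (Suc j) \<gamma>))"
  using geodesic_split(2)[OF geodesic_split(1)[OF assms(1,3)], of i] assms by (simp add: nth_append)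

lemma geodesic_prefix:
  assumes "is_fpp_geodesic V E \<omega> x y \<gamma>" "prefix \<kappa> \<gamma>" "\<kappa> \<noteq> []"
  shows "is_fpp_geodesic V E \<omega> x (last \<kappa>) \<kappa>"
proof -
  have "\<kappa> = take (Suc (length \<kappa> - 1)) \<gamma>" "length \<kappa> - 1 < length \<gamma>"
    using assms(2,3) by (cases \<kappa>; auto simp: prefix_def)+
  then show ?thesis using geodesic_split(1)[OF assms(1), of "length \<kappa> - 1"] assms(2,3)
    by (auto simp: prefix_def last_conv_nth nth_append)
qed

text \<open>A closed subpath of a geodesic is a geodesic from a vertex to itself, so it has length 0.\<close>
lemma geodesic_distinct:
  assumes "is_fpp_geodesic V E \<omega> x y \<gamma>" and pos: "\<forall>e\<in>E. 0 < \<omega> e"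
  shows "distinct \<gamma>"
proof (rule ccontr)
  assume "\<not> distinct \<gamma>"
  then obtain i j where ij: "i < j" "j < length \<gamma>" "\<gamma> ! i = \<gamma> ! j"
    by (metis distinct_conv_nth linorder_neqE_nat)
  define \<kappa> where "\<kappa> = drop i (take (Suc j) \<gamma>)"
  have \<kappa>: "is_fpp_geodesic V E \<omega> (\<gamma> ! i) (\<gamma> ! j) \<kappa>"
    unfolding \<kappa>_def using ij by (intro geodesic_segment[OF assms(1)]) auto
  then have "\<kappa> \<in> edge_paths_between V E (\<gamma> ! i) (\<gamma> ! i)" and len: "fpp_length \<omega> \<kappa> = fpp_dist V E \<omega> (\<gamma> ! i) (\<gamma> ! i)"
    using ij by (auto simp: is_fpp_geodesic_def)
  then have "\<gamma> ! i \<in> V" "edge_path V E \<kappa>"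
    using edge_paths_between_in_V[of \<kappa> V E] by (simp_all add: edge_paths_between_def)
  then have "fpp_length \<omega> \<kappa> = 0" using len dist_self by simp
  have "length \<kappa> \<ge> 2" using ij by (simp add: \<kappa>_def)
  then obtain u v \<kappa>' where k: "\<kappa> = u # v # \<kappa>'"
    by (cases \<kappa>; cases "tl \<kappa>") auto
  have "edge_path V E (v # \<kappa>')" "{u, v} \<in> E" using \<open>edge_path V E \<kappa>\<close> by (auto simp: k edge_path_def)
  then have "0 < fpp_length \<omega> \<kappa>" using length_nonneg[of "v # \<kappa>'"] pos by (auto simp: k intro: add_pos_nonneg)
  then show False using \<open>fpp_length \<omega> \<kappa> = 0\<close> by simp
qed

end

lemma fpp_length_const_1: "fpp_length (\<lambda>_. 1) \<gamma> = real (length \<gamma> - 1)"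
  by (simp add: fpp_length_def sum_list_triv)

context connected_graph begin

lemma graph_dist_attained:
  assumes "x \<in> V" "y \<in> V"
  obtains \<gamma> where "\<gamma> \<in> edge_paths_between V E x y" "real (length \<gamma> - 1) = graph_dist V E x y"
proof -
  have "(INF \<gamma>\<in>edge_paths_between V E x y. length (path_edges \<gamma>))
      \<in> (\<lambda>\<gamma>. length (path_edges \<gamma>)) ` edge_paths_between V E x y"
    using connected[OF assms] by (intro Inf_nat_def1) auto
  then show thesis using that by (auto simp: graph_dist_def)
qed

text \<open>Through this identification, the word metric inherits all the properties of first passage
  distances, and shortest paths are geodesics for unit weights.\<close>

lemma graph_dist_eq_fpp_dist:
  assumes "x \<in> V" "y \<in> V"
  shows "graph_dist V E x y = fpp_dist V E (\<lambda>_. 1) x y"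
proof -
  interpret weighted_graph V E "\<lambda>_. 1" by unfold_locales simp
  obtain \<gamma> where "\<gamma> \<in> edge_paths_between V E x y" "real (length \<gamma> - 1) = graph_dist V E x y"
    using graph_dist_attained[OF assms] .
  moreover have "graph_dist V E x y \<le> fpp_dist V E (\<lambda>_. 1) x y"
  proof (rule dist_greatest[OF assms])
    fix \<gamma> assume "\<gamma> \<in> edge_paths_between V E x y"
    then show "graph_dist V E x y \<le> fpp_length (\<lambda>_. 1) \<gamma>"
      unfolding graph_dist_def fpp_length_const_1 length_path_edges
      by (intro of_nat_mono cINF_lower) auto
  qed
  ultimately show ?thesis using dist_le_length[of \<gamma> x y] by (simp add: fpp_length_const_1)
qed

sublocale unit: weighted_graph V E "\<lambda>_. 1"
  by unfold_locales simp

lemma graph_dist_le_length: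
  "\<gamma> \<in> edge_paths_between V E x y \<Longrightarrow> graph_dist V E x y \<le> real (length \<gamma> - 1)"
  using unit.dist_le_length[of \<gamma> x y] edge_paths_between_in_V[of \<gamma>]
  by (simp add: graph_dist_eq_fpp_dist fpp_length_const_1)

lemma graph_dist_metric:
  assumes "x \<in> V" "y \<in> V"
  shows "graph_dist V E x x = 0" "0 \<le> graph_dist V E x y" "graph_dist V E x y = graph_dist V E y x"
    "z \<in> V \<Longrightarrow> graph_dist V E x z \<le> graph_dist V E x y + graph_dist V E y z"
  using assms unit.dist_self[of x] unit.dist_nonneg[of x y] unit.dist_sym[of x y]
    unit.dist_triangle[of x y z]
  by (simp_all add: graph_dist_eq_fpp_dist)

lemma graph_dist_adjacent:
  assumes "u \<in> V" "v \<in> V" "{u, v} \<in> E"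
  shows "graph_dist V E u v \<le> 1"
  using graph_dist_le_length[of "[u, v]" u v] assms by (simp add: edge_paths_between_def edge_path_def)

end

section \<open>Gromov products along far paths\<close>

text \<open>Bisection: a chain of at most \<open>2 ^ k\<close> steps is halved \<open>k\<close> times, and each time the four-point
  condition costs \<open>\<delta>\<close>.\<close>
lemma dyadic_chain:
  fixes g :: "nat \<Rightarrow> nat \<Rightarrow> real"
  assumes "0 \<le> \<delta>"
    and fourpoint: "\<And>i j k. i \<le> N \<Longrightarrow> j \<le> N \<Longrightarrow> k \<le> N \<Longrightarrow> min (g i j) (g j k) - \<delta> \<le> g i k"
    and "\<And>i. a \<le> i \<Longrightarrow> i < b \<Longrightarrow> m \<le> g i (Suc i)" "a < b" "b \<le> a + 2 ^ k" "b \<le> N"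
  shows "m - real k * \<delta> \<le> g a b"
  using assms(3-6)
proof (induction k arbitrary: a b)
  case 0
  then have "b = Suc a" by simp
  then show ?case using 0 by simp
next
  case (Suc k)
  show ?case
  proof (cases "b \<le> a + 2 ^ k")
    case True
    then have "m - real k * \<delta> \<le> g a b" using Suc.prems by (intro Suc.IH) auto
    then show ?thesis using \<open>0 \<le> \<delta>\<close> by (simp add: algebra_simps)
  next
    case False
    have "m - real k * \<delta> \<le> g a (a + 2 ^ k)" "m - real k * \<delta> \<le> g (a + 2 ^ k) b"
      using False Suc.prems by (intro Suc.IH; simp)+
    moreover have "min (g a (a + 2 ^ k)) (g (a + 2 ^ k) b) - \<delta> \<le> g a b"
      using False Suc.prems by (intro fourpoint) auto
    ultimately show ?thesis by (simp add: algebra_simps)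
  qed
qed

text \<open>The chain is cut at the indices \<open>2 ^ k\<close>. The steps from \<open>2 ^ k\<close> to \<open>2 ^ (k + 1)\<close> have products
  of at least \<open>R / 2 + c 2 ^ k / 2 - 1 / 2\<close> (the mean of the two terms of the maximum), bisection
  costs \<open>k \<delta>\<close>, and combining the blocks costs another \<open>(k + 1) \<delta>\<close>. The exponential term outweighs these
  losses, up to a constant that depends neither on \<open>R\<close> nor on the length of the chain.\<close>
lemma linear_escape_chain:
  fixes \<delta> c :: real
  assumes "0 \<le> \<delta>" "0 < c"
  obtains B where "0 \<le> B"
    "\<And>(g :: nat \<Rightarrow> nat \<Rightarrow> real) N R. 0 < N \<Longrightarrow>
      (\<And>i j k. i \<le> N \<Longrightarrow> j \<le> N \<Longrightarrow> k \<le> N \<Longrightarrow> min (g i j) (g j k) - \<delta> \<le> g i k) \<Longrightarrow>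
      (\<And>i. i < N \<Longrightarrow> max R (c * real i) - 1 / 2 \<le> g i (Suc i)) \<Longrightarrow> R / 2 - B \<le> g 0 N"
proof -
  \<comment> \<open>the total loss at the index \<open>2 ^ k\<close>, minus the gain from linear escape\<close>
  define f where "f = (\<lambda>k::nat. (2 * real k + 1) * \<delta> + 1 / 2 - c * 2 ^ k / 2)"
  have lim: "(\<lambda>k::nat. (2 * real k + 1) / 2 ^ k) \<longlonglongrightarrow> 0" "(\<lambda>k::nat. 1 / 2 / 2 ^ k :: real) \<longlonglongrightarrow> 0"
    by real_asymp+
  have "(\<lambda>k::nat. (2 * real k + 1) / 2 ^ k * \<delta> + 1 / 2 / 2 ^ k) \<longlonglongrightarrow> 0 * \<delta> + 0"
    by (intro tendsto_add tendsto_mult_right lim)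
  then have "eventually (\<lambda>k. (2 * real k + 1) / 2 ^ k * \<delta> + 1 / 2 / 2 ^ k < c / 2) sequentially"
    by (rule order_tendstoD) (use assms in simp)
  then obtain k0 where "\<And>k. k \<ge> k0 \<Longrightarrow> (2 * real k + 1) / 2 ^ k * \<delta> + 1 / 2 / 2 ^ k < c / 2"
    by (auto simp: eventually_sequentially)
  then have k0: "f k \<le> 0" if "k \<ge> k0" for k
    using that by (force simp: f_def field_simps)
  define B0 where "B0 = Max (insert 1 (f ` {..k0}))"
  have B0: "f k \<le> B0" "1 \<le> B0" for k
  proof -
    show "f k \<le> B0"
    proof (cases "k \<le> k0")
      case False
      then have "f k \<le> 1" using k0[of k] by simp
      also have "1 \<le> B0" by (simp add: B0_def)
      finally show ?thesis .
    next
      case True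
      then show ?thesis unfolding B0_def by (intro Max_ge) auto
    qed
  qed (simp add: B0_def)
  show thesis
  proof (rule that[of "B0 + \<delta>"])
    fix g :: "nat \<Rightarrow> nat \<Rightarrow> real" and N R
    assume "0 < N" and fourpoint: "\<And>i j k. i \<le> N \<Longrightarrow> j \<le> N \<Longrightarrow> k \<le> N \<Longrightarrow> min (g i j) (g j k) - \<delta> \<le> g i k"
      and step: "\<And>i. i < N \<Longrightarrow> max R (c * real i) - 1 / 2 \<le> g i (Suc i)"
    define A where "A = R / 2 - B0"
    \<comment> \<open>The surplus \<open>k \<delta>\<close> pays for combining the later blocks, by descending induction on \<open>k\<close>.\<close>
    have *: "A + real k * \<delta> \<le> g (2 ^ k) j" if "2 ^ k < j" "j \<le> N" for k j
      using that
    proof (induction "j - 2 ^ k" arbitrary: k rule: less_induct)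
      case less
      have scale: "R / 2 + c * 2 ^ k / 2 - 1 / 2 - real k * \<delta> \<le> g (2 ^ k) i"
        if "2 ^ k < i" "i \<le> 2 ^ k + 2 ^ k" "i \<le> N" for i
      proof (rule dyadic_chain[where N = N, OF \<open>0 \<le> \<delta>\<close> fourpoint])
        fix l assume l: "2 ^ k \<le> l" "l < i"
        have "real (2 ^ k) \<le> real l" using l(1) by (simp only: of_nat_le_iff)
        then have "c * 2 ^ k \<le> c * real l" using \<open>0 < c\<close> by simp
        then show "R / 2 + c * 2 ^ k / 2 - 1 / 2 \<le> g l (Suc l)" using step[of l] l that by linarith
      qed (use that in auto)
      have le: "A + real (Suc k) * \<delta> \<le> R / 2 + c * 2 ^ k / 2 - 1 / 2 - real k * \<delta>"
        using B0(1)[of k] by (simp add: A_def f_def algebra_simps)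
      show ?case
      proof (cases "j \<le> 2 ^ k + 2 ^ k")
        case True
        then show ?thesis using scale[of j] le less.prems \<open>0 \<le> \<delta>\<close> by (simp add: algebra_simps)
      next
        case False
        have "A + real (Suc k) * \<delta> \<le> g (2 ^ Suc k) j"
          using False less.prems by (intro less.hyps diff_less_mono2) auto
        moreover have "A + real (Suc k) * \<delta> \<le> g (2 ^ k) (2 ^ Suc k)"
          using scale[of "2 ^ Suc k"] le less.prems False by simp
        moreover have "min (g (2 ^ k) (2 ^ Suc k)) (g (2 ^ Suc k) j) - \<delta> \<le> g (2 ^ k) j"
          using less.prems False by (intro fourpoint) auto
        ultimately show ?thesis by (simp add: algebra_simps)
      qed
    qed
    have s0: "A \<le> g 0 1" using step[of 0] B0(2) \<open>0 < N\<close> by (auto simp: A_def)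
    show "R / 2 - (B0 + \<delta>) \<le> g 0 N"
    proof (cases "N = 1")
      case True
      then show ?thesis using s0 \<open>0 \<le> \<delta>\<close> by (simp add: A_def)
    next
      case False
      then show ?thesis using *[of 0 N] s0 fourpoint[of 0 1 N] \<open>0 < N\<close> by (simp add: A_def)
    qed
  qed (use B0(2) assms in simp)
qed

locale hyperbolic_graph = connected_graph V E for V :: "'a set" and E +
  fixes w :: 'a and \<delta> :: real
  assumes base: "w \<in> V" and \<delta>_nonneg: "0 \<le> \<delta>"
    and fourpoint: "x \<in> V \<Longrightarrow> y \<in> V \<Longrightarrow> z \<in> V \<Longrightarrow>
      min (gromov_product (graph_dist V E) w x y) (gromov_product (graph_dist V E) w y z) - \<delta>
        \<le> gromov_product (graph_dist V E) w x z"
begin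

abbreviation "d \<equiv> graph_dist V E"
abbreviation "gp \<equiv> gromov_product (graph_dist V E) w"

lemma gp_sym: "x \<in> V \<Longrightarrow> y \<in> V \<Longrightarrow> gp x y = gp y x"
  using graph_dist_metric(3)[of x y] by (simp add: gromov_product_def)

lemma gp_self: "x \<in> V \<Longrightarrow> gp x x = d w x"
  using graph_dist_metric(1)[of x x] graph_dist_metric(3)[of x w] base by (simp add: gromov_product_def)

lemma gp_adjacent: "u \<in> V \<Longrightarrow> v \<in> V \<Longrightarrow> {u, v} \<in> E \<Longrightarrow> (d w u + d w v - 1) / 2 \<le> gp u v"
  using graph_dist_adjacent[of u v] graph_dist_metric(3)[of w u] graph_dist_metric(3)[of w v] base
  by (simp add: gromov_product_def)

text \<open>The index \<open>m\<close> plays the role of a vertex closest to \<open>w\<close>. Both halves of the path, read from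
  this vertex outwards, escape from \<open>w\<close> at linear speed, so the previous lemma applies to each.\<close>
lemma gp_far_path:
  assumes "0 < \<Lambda>"
  obtains B where
    "\<And>R \<gamma> m. 0 \<le> R \<Longrightarrow> edge_path V E \<gamma> \<Longrightarrow> m < length \<gamma> \<Longrightarrow>
      (\<And>i. i < length \<gamma> \<Longrightarrow> max R (\<bar>real i - real m\<bar> / \<Lambda>) \<le> d w (\<gamma> ! i)) \<Longrightarrow>
      R / 2 - B \<le> gp (hd \<gamma>) (last \<gamma>)"
proof -
  obtain B where "0 \<le> B" and B:
    "\<And>(g :: nat \<Rightarrow> nat \<Rightarrow> real) N R. 0 < N \<Longrightarrow>
      (\<And>i j k. i \<le> N \<Longrightarrow> j \<le> N \<Longrightarrow> k \<le> N \<Longrightarrow> min (g i j) (g j k) - \<delta> \<le> g i k) \<Longrightarrow>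
      (\<And>i. i < N \<Longrightarrow> max R (1 / \<Lambda> * real i) - 1 / 2 \<le> g i (Suc i)) \<Longrightarrow> R / 2 - B \<le> g 0 N"
    using linear_escape_chain[OF \<delta>_nonneg, of "1 / \<Lambda>"] assms by (metis zero_less_divide_1_iff)
  have one_sided: "R / 2 - B \<le> gp (hd \<gamma>) (last \<gamma>)"
    if "0 \<le> R" "edge_path V E \<gamma>" and far: "\<And>i. i < length \<gamma> \<Longrightarrow> max R (real i / \<Lambda>) \<le> d w (\<gamma> ! i)" for R \<gamma>
  proof -
    have V: "\<gamma> ! i \<in> V" if "i < length \<gamma>" for i using \<open>edge_path V E \<gamma>\<close> that by (auto simp: edge_path_def)
    have ne: "\<gamma> \<noteq> []" using that by (auto simp: edge_path_def)
    show ?thesis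
    proof (cases "length \<gamma> = 1")
      case True
      then have "gp (hd \<gamma>) (last \<gamma>) = d w (\<gamma> ! 0)"
        using gp_self[OF V[of 0]] by (simp add: hd_conv_nth last_conv_nth ne)
      then show ?thesis using far[of 0] True \<open>0 \<le> R\<close> \<open>0 \<le> B\<close> by simp
    next
      case False
      define N where "N = length \<gamma> - 1"
      have N: "0 < N" "\<And>i. i \<le> N \<Longrightarrow> i < length \<gamma>" using False ne unfolding N_def by (cases \<gamma>; auto)+
      have "R / 2 - B \<le> gp (\<gamma> ! 0) (\<gamma> ! N)"
      proof (rule B[OF N(1)])
        fix i assume "i < N"
        then have i: "i < length \<gamma>" "Suc i < length \<gamma>" using N(2)[of "Suc i"] by auto
        have eq: "1 / \<Lambda> * real i = real i / \<Lambda>" by simp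
        have "real i / \<Lambda> \<le> real (Suc i) / \<Lambda>" using assms by (simp add: divide_right_mono)
        then have "max R (real i / \<Lambda>) \<le> d w (\<gamma> ! i)" "max R (real i / \<Lambda>) \<le> d w (\<gamma> ! Suc i)"
          using far[OF i(1)] far[OF i(2)] by (auto)
        moreover have "M \<le> a \<Longrightarrow> M \<le> b \<Longrightarrow> M - 1 / 2 \<le> (a + b - 1) / 2" for M a b :: real
          by (simp add: field_simps)
        ultimately have "max R (1 / \<Lambda> * real i) - 1 / 2 \<le> (d w (\<gamma> ! i) + d w (\<gamma> ! Suc i) - 1) / 2"
          unfolding eq by blast
        also have "\<dots> \<le> gp (\<gamma> ! i) (\<gamma> ! Suc i)"
          by (rule gp_adjacent[OF V[OF i(1)] V[OF i(2)] edge_path_adjacent[OF that(2) i(2)]])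
        finally show "max R (1 / \<Lambda> * real i) - 1 / 2 \<le> gp (\<gamma> ! i) (\<gamma> ! Suc i)" .
      qed (intro fourpoint V N(2); assumption)
      then show ?thesis by (simp add: hd_conv_nth last_conv_nth ne N_def)
    qed
  qed
  show thesis
  proof (rule that[of "B + \<delta>"])
    fix R \<gamma> m
    assume *: "0 \<le> R" "edge_path V E \<gamma>" "m < length \<gamma>"
      and far: "\<And>i. i < length \<gamma> \<Longrightarrow> max R (\<bar>real i - real m\<bar> / \<Lambda>) \<le> d w (\<gamma> ! i)"
    have p: "edge_path V E (rev (take (Suc m) \<gamma>))" "edge_path V E (drop m \<gamma>)"
      using edge_path_split[OF *(3)] *(2) by auto
    have "R / 2 - B \<le> gp (hd (rev (take (Suc m) \<gamma>))) (last (rev (take (Suc m) \<gamma>)))"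
    proof (rule one_sided[OF *(1) p(1)])
      fix i assume "i < length (rev (take (Suc m) \<gamma>))"
      then have "i \<le> m" using *(3) by simp
      then show "max R (real i / \<Lambda>) \<le> d w (rev (take (Suc m) \<gamma>) ! i)"
        using far[of "m - i"] *(3) by (simp add: rev_nth of_nat_diff min_absorb2)
    qed
    moreover have "R / 2 - B \<le> gp (hd (drop m \<gamma>)) (last (drop m \<gamma>))"
    proof (rule one_sided[OF *(1) p(2)])
      fix i assume "i < length (drop m \<gamma>)"
      then show "max R (real i / \<Lambda>) \<le> d w (drop m \<gamma> ! i)" using far[of "m + i"] by simp
    qed
    moreover have "hd (rev (take (Suc m) \<gamma>)) = \<gamma> ! m" "last (rev (take (Suc m) \<gamma>)) = hd \<gamma>"
      using *(3) by (simp_all add: hd_rev last_rev split_at_nth(2)) (cases \<gamma>; simp add: hd_append)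
    moreover have "hd (drop m \<gamma>) = \<gamma> ! m" "last (drop m \<gamma>) = last \<gamma>"
      using *(3) by (simp_all add: hd_drop_conv_nth)
    moreover have "\<gamma> ! m \<in> V" "hd \<gamma> \<in> V" "last \<gamma> \<in> V" using *(2,3) by (auto simp: edge_path_def)
    ultimately show "R / 2 - (B + \<delta>) \<le> gp (hd \<gamma>) (last \<gamma>)"
      using fourpoint[of "hd \<gamma>" "\<gamma> ! m" "last \<gamma>"] gp_sym[of "\<gamma> ! m" "hd \<gamma>"] by simp
  qed
qed

end

section \<open>The Gromov boundary\<close>

context hyperbolic_graph begin

text \<open>For two Gromov sequences, this says that they represent the same boundary point.\<close>
definition gp_diverges :: "(nat \<Rightarrow> 'a) \<Rightarrow> (nat \<Rightarrow> 'a) \<Rightarrow> bool" where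
  "gp_diverges x y \<longleftrightarrow> (\<forall>C::real. \<exists>N. \<forall>i\<ge>N. \<forall>j\<ge>N. C \<le> gp (x i) (y j))"

lemma gp_divergesI:
  assumes "\<And>C. \<exists>N. \<forall>i\<ge>N. \<forall>j\<ge>N. C \<le> gp (x i) (y j)"
  shows "gp_diverges x y"
  using assms unfolding gp_diverges_def by (rule allI)

lemma gp_divergesD: "gp_diverges x y \<Longrightarrow> \<exists>N. \<forall>i\<ge>N. \<forall>j\<ge>N. C \<le> gp (x i) (y j)"
  unfolding gp_diverges_def by (rule spec)

lemma filterlim_gp_iff:
  "filterlim (\<lambda>(i, j). gp (x i) (y j)) at_top (sequentially \<times>\<^sub>F sequentially) \<longleftrightarrow> gp_diverges x y"
  unfolding filterlim_at_top eventually_prod_sequentially prod.case gp_diverges_def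
  by (intro all_cong1 ex_cong1 iffI allI impI) simp_all

lemma gromov_sequences_iff: "x \<in> gromov_sequences V d w \<longleftrightarrow> range x \<subseteq> V \<and> gp_diverges x x"
  by (simp add: gromov_sequences_def filterlim_gp_iff)

lemma gromov_equivalence_iff:
  "(x, y) \<in> gromov_equivalence V d w \<longleftrightarrow>
    x \<in> gromov_sequences V d w \<and> y \<in> gromov_sequences V d w \<and> gp_diverges x y"
  by (simp add: gromov_equivalence_def filterlim_gp_iff)

lemma gp_diverges_trans:
  assumes "range x \<subseteq> V" "range y \<subseteq> V" "range z \<subseteq> V" "gp_diverges x y" "gp_diverges y z"
  shows "gp_diverges x z"
proof (rule gp_divergesI)
  fix C
  obtain N where N: "\<forall>i\<ge>N. \<forall>j\<ge>N. C + \<delta> \<le> gp (x i) (y j)"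
    using gp_divergesD[OF assms(4)] ..
  obtain M where M: "\<forall>i\<ge>M. \<forall>j\<ge>M. C + \<delta> \<le> gp (y i) (z j)"
    using gp_divergesD[OF assms(5)] ..
  have *: "C \<le> gp (x i) (z j)" if "i \<ge> max N M" "j \<ge> max N M" for i j
  proof -
    have "C + \<delta> \<le> gp (x i) (y (max N M))" using that by (intro N[rule_format]) simp_all
    moreover have "C + \<delta> \<le> gp (y (max N M)) (z j)" using that by (intro M[rule_format]) simp_all
    moreover have "min (gp (x i) (y (max N M))) (gp (y (max N M)) (z j)) - \<delta> \<le> gp (x i) (z j)"
      using assms(1-3) by (intro fourpoint) auto
    ultimately show ?thesis by linarith
  qed
  show "\<exists>N. \<forall>i\<ge>N. \<forall>j\<ge>N. C \<le> gp (x i) (z j)" by (intro exI[of _ "max N M"] allI impI *)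
qed

lemma gp_diverges_sym:
  assumes "range x \<subseteq> V" "range y \<subseteq> V" "gp_diverges x y"
  shows "gp_diverges y x"
proof (rule gp_divergesI)
  fix C
  obtain N where N: "\<forall>i\<ge>N. \<forall>j\<ge>N. C \<le> gp (x i) (y j)"
    using gp_divergesD[OF assms(3)] ..
  have "C \<le> gp (y i) (x j)" if "N \<le> i" "N \<le> j" for i j
  proof -
    have "C \<le> gp (x j) (y i)" using N[rule_format, of j i] that by blast
    also have "\<dots> = gp (y i) (x j)" using assms(1,2) by (intro gp_sym) auto
    finally show ?thesis .
  qed
  then show "\<exists>N. \<forall>i\<ge>N. \<forall>j\<ge>N. C \<le> gp (y i) (x j)" by blast
qed

lemma equiv_gromov: "equiv (gromov_sequences V d w) (gromov_equivalence V d w)"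
proof (rule equivI)
  show "refl_on (gromov_sequences V d w) (gromov_equivalence V d w)"
    by (simp add: refl_on_def gromov_equivalence_iff gromov_sequences_iff)
  show "sym (gromov_equivalence V d w)"
    using gp_diverges_sym by (auto simp: sym_def gromov_equivalence_iff gromov_sequences_iff)
  show "trans (gromov_equivalence V d w)"
  proof (rule transI)
    fix x y z
    assume "(x, y) \<in> gromov_equivalence V d w" "(y, z) \<in> gromov_equivalence V d w"
    then show "(x, z) \<in> gromov_equivalence V d w"
      using gp_diverges_trans[of x y z] by (simp add: gromov_equivalence_iff gromov_sequences_iff)
  qed
qed (auto simp: gromov_equivalence_def)

lemma boundary_sequence_diverges:
  assumes "converges_to_boundary V d w x \<xi>"
  shows "range x \<subseteq> V" "gp_diverges x x"
proof -
  have "x \<in> gromov_sequences V d w"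
    using assms in_quotient_imp_subset[OF equiv_gromov]
    by (auto simp: converges_to_boundary_def gromov_boundary_def)
  then show "range x \<subseteq> V" "gp_diverges x x" by (simp_all add: gromov_sequences_iff)
qed

lemma converges_to_boundaryI:
  assumes "converges_to_boundary V d w x \<xi>" "range v \<subseteq> V" "gp_diverges x v"
  shows "converges_to_boundary V d w v \<xi>"
proof -
  note x = boundary_sequence_diverges[OF assms(1)]
  have "gp_diverges v v"
    by (rule gp_diverges_trans[OF assms(2) x(1) assms(2)
          gp_diverges_sym[OF x(1) assms(2,3)] assms(3)])
  then have "(x, v) \<in> gromov_equivalence V d w"
    using x assms by (simp add: gromov_equivalence_iff gromov_sequences_iff)
  then show ?thesis
    using in_quotient_imp_closed[OF equiv_gromov] assms(1)
    by (auto simp: converges_to_boundary_def gromov_boundary_def)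
qed

text \<open>If \<open>r\<close> itself converges to \<open>\<xi>\<close>, then so does every sequence on \<open>r\<close> that converges to some boundary
  point, because such a sequence leaves each initial segment of \<open>r\<close>.\<close>
lemma has_directionI:
  assumes "converges_to_boundary V d w x \<xi>" "range r \<subseteq> V" and lim: "gp_diverges x r"
  shows "has_direction V d w r \<xi>"
proof -
  note x = boundary_sequence_diverges[OF assms(1)]
  have "accumulates_on V d w r \<xi>"
    using converges_to_boundaryI[OF assms] unfolding accumulates_on_def by (intro exI[of _ r]) simp
  moreover have "\<eta> = \<xi>" if acc: "accumulates_on V d w r \<eta>" for \<eta>
  proof -
    obtain v where v: "\<And>n. v n \<in> range r" and conv: "converges_to_boundary V d w v \<eta>"
      using acc unfolding accumulates_on_def by auto
    note vV = boundary_sequence_diverges[OF conv]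
    have "\<exists>k. v n = r k" for n using v[of n] by auto
    then obtain k where k: "\<And>n. v n = r (k n)" by metis
    have "gp_diverges x v"
    proof (rule gp_divergesI)
      fix C
      obtain K where K: "\<forall>i\<ge>K. \<forall>j\<ge>K. C \<le> gp (x i) (r j)"
        using gp_divergesD[OF lim] ..
      define D where "D = Max (insert 0 ((\<lambda>j. d w (r j)) ` {..<K}))"
      \<comment> \<open>The initial segment before \<open>K\<close> lies in a ball around \<open>w\<close>, which \<open>v\<close> finally leaves.\<close>
      obtain M where M: "\<forall>i\<ge>M. \<forall>j\<ge>M. D + 1 \<le> gp (v i) (v j)"
        using gp_divergesD[OF vV(2)] ..
      have kK: "K \<le> k j" if "M \<le> j" for j
      proof (rule ccontr)
        assume "\<not> K \<le> k j"
        then have "d w (v j) \<le> D" unfolding D_def by (intro Max_ge) (auto simp: k)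
        moreover have "gp (v j) (v j) = d w (v j)" using vV(1) by (intro gp_self) auto
        moreover have "D + 1 \<le> gp (v j) (v j)" using that by (intro M[rule_format])
        ultimately show False by simp
      qed
      have *: "C \<le> gp (x i) (v j)" if "max K M \<le> i" "max K M \<le> j" for i j
        unfolding k using that kK[of j] by (intro K[rule_format]) simp_all
      show "\<exists>N. \<forall>i\<ge>N. \<forall>j\<ge>N. C \<le> gp (x i) (v j)" by (intro exI[of _ "max K M"] allI impI *)
    qed
    then have "converges_to_boundary V d w v \<xi>" by (intro converges_to_boundaryI[OF assms(1) vV(1)])
    then show ?thesis
      using conv quotient_disj[OF equiv_gromov, of \<eta> \<xi>]
      unfolding converges_to_boundary_def gromov_boundary_def by blast
  qed
  ultimately show ?thesis unfolding has_direction_def by blast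
qed

end

section \<open>Counting in graphs of bounded degree\<close>

locale bounded_degree_graph = connected_graph V E for V :: "'a set" and E +
  fixes D :: nat
  assumes edge_ends: "e \<in> E \<Longrightarrow> \<exists>u\<in>V. \<exists>v\<in>V. e = {u, v}"
    and finite_nbrs: "v \<in> V \<Longrightarrow> finite {u \<in> V. {v, u} \<in> E}"
    and card_nbrs: "v \<in> V \<Longrightarrow> card {u \<in> V. {v, u} \<in> E} \<le> D"
begin

definition walks :: "nat \<Rightarrow> 'a \<Rightarrow> 'a list set" where
  "walks n u = {\<gamma>. edge_path V E \<gamma> \<and> hd \<gamma> = u \<and> length \<gamma> = Suc n}"

lemma walks_Suc: "walks (Suc n) u \<subseteq> (\<Union>v\<in>{v \<in> V. {u, v} \<in> E}. (#) u ` walks n v)"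
proof
  fix \<gamma> assume "\<gamma> \<in> walks (Suc n) u"
  then obtain v \<kappa> where "\<gamma> = u # v # \<kappa>" "edge_path V E (u # v # \<kappa>)" "length \<kappa> = n"
    unfolding walks_def by (auto simp: length_Suc_conv)
  then show "\<gamma> \<in> (\<Union>v\<in>{v \<in> V. {u, v} \<in> E}. (#) u ` walks n v)"
    by (auto simp: walks_def edge_path_def)
qed

lemma finite_card_walks: "u \<in> V \<Longrightarrow> finite (walks n u) \<and> card (walks n u) \<le> D ^ n"
proof (induction n arbitrary: u)
  case 0
  have "walks 0 u \<subseteq> {[u]}" by (auto simp: walks_def length_Suc_conv)
  then show ?case using finite_subset card_mono[of "{[u]}" "walks 0 u"] by auto
next
  case (Suc n)
  let ?N = "{v \<in> V. {u, v} \<in> E}"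
  have fin: "finite (\<Union>v\<in>?N. (#) u ` walks n v)" using Suc finite_nbrs by auto
  have "card (walks (Suc n) u) \<le> card (\<Union>v\<in>?N. (#) u ` walks n v)"
    by (rule card_mono[OF fin walks_Suc])
  also have "\<dots> \<le> (\<Sum>v\<in>?N. card ((#) u ` walks n v))"
    by (rule card_UN_le) (use Suc finite_nbrs in auto)
  also have "\<dots> \<le> (\<Sum>v\<in>?N. D ^ n)"
    using Suc.IH by (intro sum_mono order_trans[OF card_image_le]) auto
  also have "\<dots> \<le> D ^ Suc n" using card_nbrs[OF Suc.prems] by simp
  finally show ?case using finite_subset[OF walks_Suc fin] by simp
qed

lemma ball_subset_walks:
  assumes "u \<in> V"
  shows "{v \<in> V. graph_dist V E u v \<le> real n} \<subseteq> (\<Union>m\<le>n. last ` walks m u)"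
proof
  fix v assume v: "v \<in> {v \<in> V. graph_dist V E u v \<le> real n}"
  then obtain \<gamma> where \<gamma>: "\<gamma> \<in> edge_paths_between V E u v" "real (length \<gamma> - 1) = graph_dist V E u v"
    using graph_dist_attained[OF assms, of v] by auto
  then have "\<gamma> \<in> walks (length \<gamma> - 1) u" "v = last \<gamma>" "length \<gamma> - 1 \<le> n"
    using v by (auto simp: walks_def edge_paths_between_def edge_path_def)
  then show "v \<in> (\<Union>m\<le>n. last ` walks m u)" by blast
qed

lemma finite_card_ball:
  assumes "u \<in> V"
  shows "finite {v \<in> V. graph_dist V E u v \<le> real n}"
    and "card {v \<in> V. graph_dist V E u v \<le> real n} \<le> (D + 1) ^ n"
proof -
  have fin: "finite (\<Union>m\<le>n. last ` walks m u)" using finite_card_walks[OF assms] by auto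
  then show "finite {v \<in> V. graph_dist V E u v \<le> real n}"
    by (rule finite_subset[OF ball_subset_walks[OF assms]])
  have "card {v \<in> V. graph_dist V E u v \<le> real n} \<le> card (\<Union>m\<le>n. last ` walks m u)"
    by (rule card_mono[OF fin ball_subset_walks[OF assms]])
  also have "\<dots> \<le> (\<Sum>m\<le>n. card (last ` walks m u))"
    by (rule card_UN_le) simp
  also have "\<dots> \<le> (\<Sum>m\<le>n. D ^ m)"
    using finite_card_walks[OF assms] by (intro sum_mono order_trans[OF card_image_le]) auto
  also have "\<dots> \<le> (D + 1) ^ n"
  proof (induction n)
    case (Suc n)
    have "D ^ n \<le> (D + 1) ^ n" by (rule power_mono) auto
    then have le: "D * D ^ n \<le> D * (D + 1) ^ n" by (rule mult_le_mono2)
    have "(\<Sum>m\<le>Suc n. D ^ m) = (\<Sum>m\<le>n. D ^ m) + D * D ^ n" by simp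
    also have "\<dots> \<le> (D + 1) ^ n + D * (D + 1) ^ n" by (rule add_mono[OF Suc le])
    also have "\<dots> = (D + 1) ^ Suc n" by simp
    finally show ?case .
  qed simp
  finally show "card {v \<in> V. graph_dist V E u v \<le> real n} \<le> (D + 1) ^ n" .
qed

lemma finite_ball_real:
  assumes "u \<in> V"
  shows "finite {v \<in> V. graph_dist V E u v \<le> R}"
proof (rule finite_subset[OF _ finite_card_ball(1)[OF assms, of "nat \<lceil>R\<rceil>"]])
  have "R \<le> real (nat \<lceil>R\<rceil>)" by linarith
  then show "{v \<in> V. graph_dist V E u v \<le> R} \<subseteq> {v \<in> V. graph_dist V E u v \<le> real (nat \<lceil>R\<rceil>)}"
    by auto
qed

lemma countable_V: "countable V"
proof (cases "V = {}")
  case False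
  then obtain u where u: "u \<in> V" by blast
  have "V \<subseteq> (\<Union>n. {v \<in> V. graph_dist V E u v \<le> real n})" using real_arch_simple by blast
  moreover have "countable (\<Union>n. {v \<in> V. graph_dist V E u v \<le> real n})"
    by (rule countable_UN) (simp_all add: countable_finite finite_card_ball(1)[OF u])
  ultimately show ?thesis by (rule countable_subset)
qed simp

lemma countable_E: "countable E"
proof (rule countable_subset)
  show "E \<subseteq> (\<lambda>(u, v). {u, v}) ` (V \<times> V)" using edge_ends by fast
qed (use countable_V in auto)

end

section \<open>Limits of paths\<close>

text \<open>This is Koenig's lemma: an initial segment shared by infinitely many of the paths can be
  prolonged by one vertex so that infinitely many paths still share it, as there are only finitely
  many candidates.\<close>
lemma paths_have_limit_ray:
  fixes \<gamma> :: "nat \<Rightarrow> 'a list"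
  assumes start: "\<And>n. \<gamma> n \<noteq> []" "\<And>n. hd (\<gamma> n) = p"
    and fin: "\<And>n i. Suc i < length (\<gamma> n) \<Longrightarrow> finite (N (\<gamma> n ! i))"
    and step: "\<And>n i. Suc i < length (\<gamma> n) \<Longrightarrow> \<gamma> n ! Suc i \<in> N (\<gamma> n ! i)"
    and long: "\<And>L. \<exists>M. \<forall>n\<ge>M. L \<le> length (\<gamma> n)"
  obtains \<phi> r where "strict_mono \<phi>" "r 0 = p" "paths_converge_to_ray (\<lambda>n. \<gamma> (\<phi> n)) r"
proof -
  define freq where "freq l \<longleftrightarrow> infinite {n. prefix l (\<gamma> n)}" for l
  have extend: "\<exists>v. freq (l @ [v])" if "freq l" "l \<noteq> []" for l
  proof -
    let ?A = "{n. prefix l (\<gamma> n) \<and> Suc (length l) \<le> length (\<gamma> n)}"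
    obtain M where M: "\<forall>n\<ge>M. Suc (length l) \<le> length (\<gamma> n)" using long ..
    have "{n. prefix l (\<gamma> n)} \<subseteq> ?A \<union> {..<M}" using M by (auto simp: not_less)
    then have inf: "infinite ?A"
      using \<open>freq l\<close> finite_subset[of "{n. prefix l (\<gamma> n)}" "?A \<union> {..<M}"] by (auto simp: freq_def)
    let ?f = "\<lambda>n. \<gamma> n ! length l"
    have l: "\<gamma> n ! (length l - 1) = last l" "Suc (length l - 1) = length l" if "prefix l (\<gamma> n)" for n
      using that \<open>l \<noteq> []\<close> by (auto simp: prefix_def nth_append last_conv_nth)
    obtain n0 where n0: "n0 \<in> ?A" using inf by (metis ex_in_conv finite.emptyI)
    have "finite (N (last l))" using fin[of "length l - 1" n0] l[of n0] n0 by simp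
    moreover have "?f ` ?A \<subseteq> N (last l)"
    proof
      fix v assume "v \<in> ?f ` ?A"
      then obtain n where n: "n \<in> ?A" "v = ?f n" by blast
      then show "v \<in> N (last l)" using step[of "length l - 1" n] l[of n] by simp
    qed
    ultimately have "finite (?f ` ?A)" by (rule finite_subset[rotated])
    then obtain n1 where n1: "n1 \<in> ?A" "infinite {n \<in> ?A. ?f n = ?f n1}"
      using pigeonhole_infinite[OF inf] by blast
    have "{n \<in> ?A. ?f n = ?f n1} \<subseteq> {n. prefix (l @ [?f n1]) (\<gamma> n)}"
      by (auto simp: Suc_le_eq intro: append_one_prefix)
        (metis append_one_prefix)
    then show ?thesis using n1(2) finite_subset unfolding freq_def by blast
  qed
  have "freq [p]"
  proof -
    have "prefix [p] (\<gamma> n)" for n using start[of n] by (cases "\<gamma> n") auto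
    then show ?thesis by (simp add: freq_def)
  qed
  have "\<exists>L. \<forall>k. (freq (L k) \<and> length (L k) = Suc k \<and> hd (L k) = p) \<and> (\<exists>v. L (Suc k) = L k @ [v])"
  proof (intro dependent_nat_choice)
    show "\<exists>l. freq l \<and> length l = Suc 0 \<and> hd l = p" using \<open>freq [p]\<close> by (intro exI[of _ "[p]"]) simp
    fix l k assume l: "freq l \<and> length l = Suc k \<and> hd l = p"
    then have "l \<noteq> []" by auto
    then show "\<exists>l'. (freq l' \<and> length l' = Suc (Suc k) \<and> hd l' = p) \<and> (\<exists>v. l' = l @ [v])"
      using extend[of l] l by (metis hd_append2 length_append_singleton)
  qed
  then obtain L where L: "\<And>k. freq (L k) \<and> length (L k) = Suc k \<and> hd (L k) = p"
      "\<And>k. \<exists>v. L (Suc k) = L k @ [v]"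
    by metis
  define r where "r k = last (L k)" for k
  have r: "L k = map r [0..<Suc k]" for k
  proof (induction k)
    case 0
    then show ?case using L(1)[of 0] by (auto simp: r_def length_Suc_conv)
  next
    case (Suc k)
    then show ?case using L(2)[of k] by (auto simp: r_def)
  qed
  have "\<exists>\<phi>. \<forall>k. prefix (L k) (\<gamma> (\<phi> k)) \<and> \<phi> k < \<phi> (Suc k)"
  proof (intro dependent_nat_choice)
    show "\<exists>n. prefix (L 0) (\<gamma> n)" using L(1)[of 0] not_finite_existsD unfolding freq_def by blast
    fix n k
    show "\<exists>m. prefix (L (Suc k)) (\<gamma> m) \<and> n < m"
      using L(1)[of "Suc k"] unfolding freq_def infinite_nat_iff_unbounded by blast
  qed
  then obtain \<phi> where \<phi>: "\<And>k. prefix (L k) (\<gamma> (\<phi> k))" "\<And>k. \<phi> k < \<phi> (Suc k)" by blast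
  show thesis
  proof (rule that)
    show "strict_mono \<phi>" using \<phi>(2) by (simp add: strict_mono_Suc_iff)
    show "r 0 = p" using L(1)[of 0] by (auto simp: r_def length_Suc_conv)
    show "paths_converge_to_ray (\<lambda>n. \<gamma> (\<phi> n)) r"
      unfolding paths_converge_to_ray_def
    proof
      fix k
      have "prefix (map r [0..<Suc k]) (\<gamma> (\<phi> n))" if "k \<le> n" for n
      proof -
        have "[0..<Suc n] = [0..<Suc k] @ [Suc k..<Suc n]"
          using that upt_add_eq_append[of 0 "Suc k" "n - k"] by simp
        then have "prefix (L k) (L n)" unfolding r by (simp del: upt_Suc)
        then show ?thesis using \<phi>(1)[of n] unfolding r by (rule prefix_order.trans)
      qed
      then show "\<forall>\<^sub>F n in sequentially. prefix (map r [0..<Suc k]) (\<gamma> (\<phi> n))"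
        by (auto simp: eventually_sequentially)
    qed
  qed
qed

section \<open>Geodesics for regular weights\<close>

lemma finite_has_argmin:
  fixes f :: "'b \<Rightarrow> real"
  assumes "finite S" "S \<noteq> {}"
  shows "\<exists>m\<in>S. \<forall>x\<in>S. f m \<le> f x"
  using arg_min_if_finite[OF assms, of f] by (intro bexI[of _ "arg_min_on f S"]) (auto simp: not_less)

text \<open>The properties of the weights that hold almost surely and suffice for the convergence of
  geodesics: positivity, the separation of simple paths by their lengths, which makes geodesics from
  \<open>p\<close> unique, and the two linear bounds far away from \<open>w\<close>. The paths in the lower bound need not
  start at \<open>p\<close>, because the bound is applied to segments of geodesics.\<close>
locale regular_weights = hyperbolic_graph V E w \<delta> + bounded_degree_graph V E D + weighted_graph V E \<omega>
  for V :: "'a set" and E w \<delta> D \<omega> +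
  fixes p :: 'a and K \<epsilon> :: real and N :: nat
  assumes p: "p \<in> V"
    and pos: "\<forall>e\<in>E. 0 < \<omega> e"
    and inj_length: "\<And>\<gamma> \<gamma>'. edge_path V E \<gamma> \<Longrightarrow> edge_path V E \<gamma>' \<Longrightarrow> distinct \<gamma> \<Longrightarrow> distinct \<gamma>' \<Longrightarrow>
      hd \<gamma> = p \<Longrightarrow> hd \<gamma>' = p \<Longrightarrow> fpp_length \<omega> \<gamma> = fpp_length \<omega> \<gamma>' \<Longrightarrow> \<gamma> = \<gamma>'"
    and upper: "\<And>v. v \<in> V \<Longrightarrow> real N \<le> d w v \<Longrightarrow> fpp_dist V E \<omega> w v \<le> K * d w v"
    and K: "0 \<le> K" and \<epsilon>: "0 < \<epsilon>"
    and lower: "\<And>\<gamma>. edge_path V E \<gamma> \<Longrightarrow> distinct \<gamma> \<Longrightarrow> N \<le> length \<gamma> - 1 \<Longrightarrow>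
      d w (hd \<gamma>) \<le> real (length \<gamma> - 1) \<Longrightarrow> \<epsilon> * real (length \<gamma> - 1) \<le> fpp_length \<omega> \<gamma>"
begin

abbreviation "d\<omega> \<equiv> fpp_dist V E \<omega>"

text \<open>Only finitely many simple paths compete: by the lower bound, those with more than \<open>M\<close> edges are
  longer than a given path \<open>\<gamma>0\<close>.\<close>
lemma geodesic_exists:
  assumes "y \<in> V"
  shows "\<exists>\<gamma>. is_fpp_geodesic V E \<omega> p y \<gamma>"
proof -
  obtain \<gamma>0 where \<gamma>0: "\<gamma>0 \<in> edge_paths_between V E p y" using connected[OF p assms] by blast
  define M where "M = max N (nat \<lceil>max (d w p) (fpp_length \<omega> \<gamma>0 / \<epsilon>)\<rceil> + 1)"
  have M: "N \<le> M" "d w p \<le> real M" "fpp_length \<omega> \<gamma>0 / \<epsilon> < real M" unfolding M_def by linarith+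
  define F where "F = insert \<gamma>0 {\<gamma> \<in> edge_paths_between V E p y. distinct \<gamma> \<and> length \<gamma> - 1 \<le> M}"
  have "F \<subseteq> insert \<gamma>0 (\<Union>n\<le>M. walks n p)"
    by (auto simp: F_def walks_def edge_paths_between_def edge_path_def)
  moreover have "finite (insert \<gamma>0 (\<Union>n\<le>M. walks n p))" using finite_card_walks[OF p] by auto
  ultimately have "finite F" by (rule finite_subset)
  then obtain \<gamma> where \<gamma>: "\<gamma> \<in> F" "\<And>\<kappa>. \<kappa> \<in> F \<Longrightarrow> fpp_length \<omega> \<gamma> \<le> fpp_length \<omega> \<kappa>"
    using finite_has_argmin[of F "fpp_length \<omega>"] by (auto simp: F_def)
  have \<gamma>_between: "\<gamma> \<in> edge_paths_between V E p y" using \<gamma>(1) \<gamma>0 by (auto simp: F_def)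
  have "fpp_length \<omega> \<gamma> \<le> d\<omega> p y"
  proof (rule dist_greatest[OF p assms])
    fix \<kappa> assume "\<kappa> \<in> edge_paths_between V E p y"
    from simple_subpath[OF this]
    obtain \<kappa>' where \<kappa>': "\<kappa>' \<in> edge_paths_between V E p y" "distinct \<kappa>'"
        and le: "\<forall>\<omega>. (\<forall>e\<in>E. 0 \<le> \<omega> e) \<longrightarrow> fpp_length \<omega> \<kappa>' \<le> fpp_length \<omega> \<kappa>"
      by blast
    have le: "fpp_length \<omega> \<kappa>' \<le> fpp_length \<omega> \<kappa>" by (rule le[rule_format]) (rule nonneg)
    have "fpp_length \<omega> \<gamma> \<le> fpp_length \<omega> \<kappa>'"
    proof (cases "length \<kappa>' - 1 \<le> M")
      case True
      then show ?thesis using \<kappa>' by (intro \<gamma>(2)) (simp add: F_def)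
    next
      case False
      have "fpp_length \<omega> \<gamma> \<le> fpp_length \<omega> \<gamma>0" by (rule \<gamma>(2)) (simp add: F_def)
      also have "\<dots> < \<epsilon> * real M" using M(3) \<epsilon> by (simp add: field_simps)
      also have "\<dots> \<le> \<epsilon> * real (length \<kappa>' - 1)" using False \<epsilon> by simp
      also have "\<dots> \<le> fpp_length \<omega> \<kappa>'"
        using \<kappa>' False M by (intro lower) (auto simp: edge_paths_between_def)
      finally show ?thesis by simp
    qed
    then show "fpp_length \<omega> \<gamma> \<le> fpp_length \<omega> \<kappa>" using le by simp
  qed
  then have "is_fpp_geodesic V E \<omega> p y \<gamma>"
    using dist_le_length[OF \<gamma>_between] \<gamma>_between by (simp add: is_fpp_geodesic_def)
  then show ?thesis ..
qed

lemma fpp_geodesic: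
  assumes "y \<in> V"
  shows "is_fpp_geodesic V E \<omega> p y (fpp_geodesic V E \<omega> p y)"
proof -
  have "\<exists>!\<gamma>. is_fpp_geodesic V E \<omega> p y \<gamma>"
  proof (rule ex_ex1I[OF geodesic_exists[OF assms]])
    fix \<gamma> \<gamma>' assume "is_fpp_geodesic V E \<omega> p y \<gamma>" "is_fpp_geodesic V E \<omega> p y \<gamma>'"
    then show "\<gamma> = \<gamma>'"
      using geodesic_distinct[OF _ pos]
      by (intro inj_length) (auto simp: is_fpp_geodesic_def edge_paths_between_def)
  qed
  then show ?thesis unfolding fpp_geodesic_def by (rule theI')
qed

text \<open>A geodesic far from \<open>w\<close> escapes linearly on both sides of its vertex closest to \<open>w\<close>: a segment
  that starts or ends there and is too long for its other endpoint would violate the lower bound on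
  its length, since the detour through \<open>w\<close> is short by the upper bound.\<close>
lemma gp_far_geodesic:
  obtains B where "\<And>R \<gamma> a b. real N \<le> R \<Longrightarrow> is_fpp_geodesic V E \<omega> a b \<gamma> \<Longrightarrow> (\<forall>v\<in>set \<gamma>. R \<le> d w v) \<Longrightarrow>
    R / 2 - B \<le> gp a b"
proof -
  define \<Lambda> where "\<Lambda> = max 1 (2 * K / \<epsilon>)"
  have \<Lambda>: "1 \<le> \<Lambda>" "2 * K \<le> \<epsilon> * \<Lambda>" using \<epsilon> by (auto simp: \<Lambda>_def max_def field_simps)
  obtain B where B: "\<And>R \<gamma> m. 0 \<le> R \<Longrightarrow> edge_path V E \<gamma> \<Longrightarrow> m < length \<gamma> \<Longrightarrow>
      (\<And>i. i < length \<gamma> \<Longrightarrow> max R (\<bar>real i - real m\<bar> / \<Lambda>) \<le> d w (\<gamma> ! i)) \<Longrightarrow>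
      R / 2 - B \<le> gp (hd \<gamma>) (last \<gamma>)"
    using gp_far_path[of \<Lambda>] \<Lambda>(1) by (metis less_le_trans zero_less_one)
  have "R / 2 - B \<le> gp a b"
    if R: "real N \<le> R" and geo: "is_fpp_geodesic V E \<omega> a b \<gamma>" and far: "\<forall>v\<in>set \<gamma>. R \<le> d w v" for R \<gamma> a b
  proof -
    have \<gamma>: "edge_path V E \<gamma>" "hd \<gamma> = a" "last \<gamma> = b" "\<gamma> \<noteq> []" "set \<gamma> \<subseteq> V"
      using geo by (auto simp: is_fpp_geodesic_def edge_paths_between_def edge_path_def)
    \<comment> \<open>a vertex closest to \<open>w\<close>\<close>
    obtain m where m: "m < length \<gamma>" "\<And>i. i < length \<gamma> \<Longrightarrow> d w (\<gamma> ! m) \<le> d w (\<gamma> ! i)"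
    proof -
      have "{..<length \<gamma>} \<noteq> {}" using \<gamma>(4) by auto
      then show thesis
        using finite_has_argmin[of "{..<length \<gamma>}" "\<lambda>i. d w (\<gamma> ! i)"] that by auto
    qed
    have "R / 2 - B \<le> gp (hd \<gamma>) (last \<gamma>)"
    proof (rule B[OF _ \<gamma>(1) m(1)])
      fix i assume i: "i < length \<gamma>"
      have iR: "R \<le> d w (\<gamma> ! i)" using far i by simp
      have "\<bar>real i - real m\<bar> \<le> \<Lambda> * d w (\<gamma> ! i)"
      proof (rule ccontr)
        assume "\<not> \<bar>real i - real m\<bar> \<le> \<Lambda> * d w (\<gamma> ! i)"
        define s t n where "s = min i m" and "t = max i m" and "n = t - s"
        have n: "\<bar>real i - real m\<bar> = real n" by (auto simp: n_def s_def t_def)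
        then have big: "\<Lambda> * d w (\<gamma> ! i) < real n" using \<open>\<not> \<bar>real i - real m\<bar> \<le> \<Lambda> * d w (\<gamma> ! i)\<close> by simp
        have st: "s \<le> t" "t < length \<gamma>" "s < length \<gamma>" using i m(1) by (auto simp: s_def t_def)
        have near: "d w (\<gamma> ! s) \<le> d w (\<gamma> ! i)" "d w (\<gamma> ! t) \<le> d w (\<gamma> ! i)"
          using m(2)[OF i] by (auto simp: s_def t_def min_def max_def)
        have "0 \<le> d w (\<gamma> ! i)" using iR R by linarith
        then have ni: "d w (\<gamma> ! i) \<le> real n" using big \<Lambda>(1) mult_right_mono[of 1 \<Lambda> "d w (\<gamma> ! i)"] by linarith
        define \<kappa> where "\<kappa> = drop s (take (Suc t) \<gamma>)"
        have \<kappa>_geo: "is_fpp_geodesic V E \<omega> (\<gamma> ! s) (\<gamma> ! t) \<kappa>"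
          unfolding \<kappa>_def by (rule geodesic_segment[OF geo st(1,2)])
        have \<kappa>: "length \<kappa> - 1 = n" "hd \<kappa> = \<gamma> ! s" "edge_path V E \<kappa>" "fpp_length \<omega> \<kappa> = d\<omega> (\<gamma> ! s) (\<gamma> ! t)"
          using \<kappa>_geo st by (auto simp: \<kappa>_def n_def is_fpp_geodesic_def edge_paths_between_def)
        have V: "\<gamma> ! s \<in> V" "\<gamma> ! t \<in> V" using \<gamma>(5) st by auto
        have "\<epsilon> * real (length \<kappa> - 1) \<le> fpp_length \<omega> \<kappa>"
        proof (rule lower[OF \<kappa>(3) geodesic_distinct[OF \<kappa>_geo pos]])
          have "real N \<le> real n" using R iR ni by linarith
          then show "N \<le> length \<kappa> - 1" unfolding \<kappa>(1) by simp
          show "d w (hd \<kappa>) \<le> real (length \<kappa> - 1)" unfolding \<kappa>(1,2) using near ni by linarith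
        qed
        also have "\<dots> \<le> d\<omega> w (\<gamma> ! s) + d\<omega> w (\<gamma> ! t)"
          using dist_triangle[OF V(1) base V(2)] dist_sym[OF V(1) base] by (simp add: \<kappa>)
        also have "\<dots> \<le> K * d w (\<gamma> ! s) + K * d w (\<gamma> ! t)"
        proof (rule add_mono)
          have "R \<le> d w (\<gamma> ! s)" "R \<le> d w (\<gamma> ! t)" using far st by auto
          then show "d\<omega> w (\<gamma> ! s) \<le> K * d w (\<gamma> ! s)" "d\<omega> w (\<gamma> ! t) \<le> K * d w (\<gamma> ! t)"
            using R V by (auto intro: upper)
        qed
        also have "\<dots> \<le> 2 * K * d w (\<gamma> ! i)"
          using mult_left_mono[OF near(1) K] mult_left_mono[OF near(2) K] by simp
        also have "\<dots> \<le> \<epsilon> * \<Lambda> * d w (\<gamma> ! i)"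
          using \<Lambda>(2) \<open>0 \<le> d w (\<gamma> ! i)\<close> by (rule mult_right_mono)
        also have "\<dots> < \<epsilon> * real n" using big \<epsilon> by simp
        finally show False unfolding \<kappa>(1) by simp
      qed
      then have "\<bar>real i - real m\<bar> / \<Lambda> \<le> d w (\<gamma> ! i)" using \<Lambda>(1) by (simp add: field_simps)
      then show "max R (\<bar>real i - real m\<bar> / \<Lambda>) \<le> d w (\<gamma> ! i)" using iR by simp
    qed (use R in linarith)
    then show ?thesis by (simp add: \<gamma>)
  qed
  then show thesis by (intro that)
qed

text \<open>The subsequence comes from compactness. For the direction, the point is that a geodesic does not
  return to a given ball around \<open>w\<close> after it has followed the ray for a sufficiently long time.\<close>
theorem geodesics_converge_to_ray:
  assumes conv: "converges_to_boundary V d w x \<xi>"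
  shows "\<exists>\<phi> r. strict_mono (\<phi> :: nat \<Rightarrow> nat) \<and>
      is_fpp_geodesic_ray V E \<omega> r \<and> r 0 = p \<and> has_direction V d w r \<xi> \<and>
      paths_converge_to_ray (\<lambda>n. fpp_geodesic V E \<omega> p (x (\<phi> n))) r"
proof -
  define \<gamma> where "\<gamma> = (\<lambda>n. fpp_geodesic V E \<omega> p (x n))"
  note x_div = boundary_sequence_diverges[OF conv]
  have xV: "x n \<in> V" for n using x_div(1) by auto
  have geo: "is_fpp_geodesic V E \<omega> p (x n) (\<gamma> n)" for n unfolding \<gamma>_def by (rule fpp_geodesic[OF xV])
  have \<gamma>: "edge_path V E (\<gamma> n)" "hd (\<gamma> n) = p" "last (\<gamma> n) = x n" "\<gamma> n \<noteq> []" "set (\<gamma> n) \<subseteq> V" "distinct (\<gamma> n)" for n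
    using geo[of n] geodesic_distinct[OF geo[of n] pos]
    by (auto simp: is_fpp_geodesic_def edge_paths_between_def edge_path_def)
  have inV: "\<gamma> n ! i \<in> V" if "i < length (\<gamma> n)" for n i using \<gamma>(5)[of n] that by auto
  obtain \<phi> r where \<phi>: "strict_mono \<phi>" and r0: "r 0 = p" and lim: "paths_converge_to_ray (\<lambda>n. \<gamma> (\<phi> n)) r"
  proof (rule paths_have_limit_ray[of \<gamma> p "\<lambda>v. {u \<in> V. {v, u} \<in> E}"])
    fix n i assume i: "Suc i < length (\<gamma> n)"
    show "finite {u \<in> V. {\<gamma> n ! i, u} \<in> E}" using i by (intro finite_nbrs inV) simp
    show "\<gamma> n ! Suc i \<in> {u \<in> V. {\<gamma> n ! i, u} \<in> E}" using edge_path_adjacent[OF \<gamma>(1) i] inV[OF i] by simp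
  next
    fix L
    obtain M where M: "\<forall>i\<ge>M. \<forall>j\<ge>M. real L + d w p \<le> gp (x i) (x j)" using gp_divergesD[OF x_div(2)] ..
    have "L \<le> length (\<gamma> n)" if "M \<le> n" for n
    proof -
      have "real L + d w p \<le> d w (x n)" using M[rule_format, OF that that] gp_self[OF xV] by simp
      also have "\<dots> \<le> d w p + d p (x n)" by (rule graph_dist_metric(4)[OF base p xV])
      also have "d p (x n) \<le> real (length (\<gamma> n) - 1)"
        using geo by (intro graph_dist_le_length) (simp add: is_fpp_geodesic_def)
      finally show ?thesis by simp
    qed
    then show "\<exists>M. \<forall>n\<ge>M. L \<le> length (\<gamma> n)" by blast
  qed (use \<gamma> in blast)+
  have prefixes: "\<exists>n\<ge>M. prefix (map r [0..<Suc k]) (\<gamma> n)" for k M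
  proof -
    obtain n0 where n0: "\<forall>n\<ge>n0. prefix (map r [0..<Suc k]) (\<gamma> (\<phi> n))"
      using lim unfolding paths_converge_to_ray_def eventually_sequentially by blast
    have "M \<le> \<phi> (max n0 M)" using seq_suble[OF \<phi>, of "max n0 M"] by simp
    then show ?thesis using n0 by (intro exI[of _ "\<phi> (max n0 M)"]) simp
  qed
  have rV: "range r \<subseteq> V"
  proof
    fix v assume "v \<in> range r"
    then obtain k where k: "v = r k" by blast
    obtain n where "prefix (map r [0..<Suc k]) (\<gamma> n)" using prefixes[of 0 k] by blast
    then have "set (map r [0..<Suc k]) \<subseteq> V" using \<gamma>(5) set_mono_prefix by blast
    then show "v \<in> V" by (simp add: k)
  qed
  have "is_fpp_geodesic_ray V E \<omega> r"
    unfolding is_fpp_geodesic_ray_def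
  proof (intro allI impI)
    fix i j :: nat assume "i \<le> j"
    obtain n where n: "prefix (map r [0..<Suc j]) (\<gamma> n)" using prefixes[of 0 j] by blast
    have "is_fpp_geodesic V E \<omega> p (r j) (map r [0..<Suc j])" using geodesic_prefix[OF geo n] by simp
    from geodesic_segment[OF this \<open>i \<le> j\<close>]
    have "is_fpp_geodesic V E \<omega> (map r [0..<Suc j] ! i) (map r [0..<Suc j] ! j) (drop i (map r [0..<Suc j]))"
      by simp
    moreover have "map r [0..<Suc j] ! i = r i" "map r [0..<Suc j] ! j = r j"
      using \<open>i \<le> j\<close> nth_map[of i "[0..<Suc j]" r] nth_map[of j "[0..<Suc j]" r] by (simp_all del: upt_Suc)
    moreover have "drop i (map r [0..<Suc j]) = map r [i..<Suc j]"
      by (simp add: drop_map del: upt_Suc)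
    ultimately show "is_fpp_geodesic V E \<omega> (r i) (r j) (map r [i..<Suc j])" by simp
  qed
  moreover have "gp_diverges x r"
  proof (rule gp_divergesI)
    fix C
    obtain B where B: "\<And>R \<gamma> a b. real N \<le> R \<Longrightarrow> is_fpp_geodesic V E \<omega> a b \<gamma> \<Longrightarrow>
        (\<forall>v\<in>set \<gamma>. R \<le> d w v) \<Longrightarrow> R / 2 - B \<le> gp a b"
      using gp_far_geodesic by blast
    define R where "R = max (real N) (2 * (C + \<delta> + B))"
    \<comment> \<open>Beyond the index \<open>k0\<close> the distance from \<open>p\<close> along a geodesic exceeds \<open>T\<close>, the largest
      first passage distance from \<open>p\<close> to a vertex of the ball of radius \<open>R\<close>.\<close>
    define T where "T = Max (insert 0 (d\<omega> p ` {v \<in> V. d w v \<le> R}))"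
    define k0 where "k0 = max N (nat \<lceil>max (d w p) (T / \<epsilon>)\<rceil> + 1)"
    have k0: "N \<le> k0" "d w p \<le> real k0" "T / \<epsilon> < real k0" unfolding k0_def by linarith+
    obtain M where M: "\<forall>i\<ge>M. \<forall>j\<ge>M. C + \<delta> \<le> gp (x i) (x j)" using gp_divergesD[OF x_div(2)] ..
    have *: "C \<le> gp (x i) (r k)" if ik: "max M k0 \<le> i" "max M k0 \<le> k" for i k
    proof -
      obtain n where n: "M \<le> n" "prefix (map r [0..<Suc k]) (\<gamma> n)" using prefixes[of M k] by blast
      then obtain zs where zs: "\<gamma> n = map r [0..<Suc k] @ zs" by (auto simp: prefix_def)
      have k: "k < length (\<gamma> n)" "\<gamma> n ! k = r k"
        using nth_map[of k "[0..<Suc k]" r] by (simp_all add: zs nth_append del: upt_Suc)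
      have "R \<le> d w v" if "v \<in> set (drop k (\<gamma> n))" for v
      proof (rule ccontr)
        assume "\<not> R \<le> d w v"
        obtain l where "l < length (\<gamma> n) - k" "v = \<gamma> n ! (k + l)"
          using \<open>v \<in> set (drop k (\<gamma> n))\<close> k(1) by (auto simp: in_set_conv_nth)
        then obtain j where j: "k \<le> j" "j < length (\<gamma> n)" "v = \<gamma> n ! j"
          by (intro that[of "k + l"]) auto
        have "v \<in> V" using inV j by simp
        note g = geodesic_split(1)[OF geo j(2)]
        have len: "length (take (Suc j) (\<gamma> n)) - 1 = j" using j(2) by (auto simp: min_def)
        have "\<epsilon> * real k0 \<le> \<epsilon> * real j" using ik j(1) \<epsilon> by simp
        also have "\<dots> = \<epsilon> * real (length (take (Suc j) (\<gamma> n)) - 1)" unfolding len ..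
        also have "\<dots> \<le> fpp_length \<omega> (take (Suc j) (\<gamma> n))"
        proof (rule lower)
          show "edge_path V E (take (Suc j) (\<gamma> n))"
            using g by (simp add: is_fpp_geodesic_def edge_paths_between_def)
          show "d w (hd (take (Suc j) (\<gamma> n))) \<le> real (length (take (Suc j) (\<gamma> n)) - 1)"
            "N \<le> length (take (Suc j) (\<gamma> n)) - 1"
            unfolding len using k0(1,2) ik j(1,2) \<gamma>(2)[of n] by simp_all
        qed (simp add: \<gamma>)
        also have "\<dots> = d\<omega> p v" using g j(3) by (simp add: is_fpp_geodesic_def)
        also have "\<dots> \<le> T"
          unfolding T_def using \<open>v \<in> V\<close> \<open>\<not> R \<le> d w v\<close> finite_ball_real[OF base] by (intro Max_ge) auto
        also have "T < \<epsilon> * real k0" using k0(3) \<epsilon> by (simp add: field_simps)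
        finally show False by simp
      qed
      then have "R / 2 - B \<le> gp (r k) (x n)"
        using geodesic_split(2)[OF geo k(1)] by (intro B[of R _ _ "drop k (\<gamma> n)"]) (auto simp: R_def k(2))
      moreover have "C + \<delta> \<le> R / 2 - B" unfolding R_def by (simp add: field_simps max_def)
      moreover have "gp (r k) (x n) = gp (x n) (r k)" using rV xV by (intro gp_sym) auto
      ultimately have "C + \<delta> \<le> gp (x n) (r k)" by linarith
      moreover have "C + \<delta> \<le> gp (x i) (x n)" using M n(1) ik by simp
      moreover have "min (gp (x i) (x n)) (gp (x n) (r k)) - \<delta> \<le> gp (x i) (r k)"
        using xV rV by (intro fourpoint) auto
      ultimately show ?thesis by linarith
    qed
    show "\<exists>N. \<forall>i\<ge>N. \<forall>j\<ge>N. C \<le> gp (x i) (r j)" by (intro exI[of _ "max M k0"] allI impI *)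
  qed
  then have "has_direction V d w r \<xi>" by (rule has_directionI[OF conv rV])
  ultimately show ?thesis using \<phi> r0 lim unfolding \<gamma>_def by blast
qed

end

section \<open>Independent weights\<close>

locale edge_weight = prob_space \<mu> for \<mu> :: "real measure" +
  assumes id_measurable [measurable]: "(\<lambda>x. x) \<in> borel_measurable \<mu>"
    and nonneg_space: "x \<in> space \<mu> \<Longrightarrow> 0 \<le> x"
    and diffuse: "AE x in \<mu>. x \<noteq> c"
    and exp_moment: "(\<integral>\<^sup>+ x. ennreal (exp x) \<partial>\<mu>) < \<infinity>"
begin

abbreviation "weights I \<equiv> (\<Pi>\<^sub>M e\<in>I. \<mu>)"

lemma prob_space_weights: "prob_space (weights I)"
  by (rule prob_space_PiM) (rule prob_space_axioms)

lemma component_measurable: "e \<in> I \<Longrightarrow> (\<lambda>\<omega>. \<omega> e) \<in> borel_measurable (weights I)"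
  using measurable_compose[OF measurable_component_singleton[of e I "\<lambda>_. \<mu>"] id_measurable] by simp

lemma sum_measurable: "J \<subseteq> I \<Longrightarrow> (\<lambda>\<omega>. \<Sum>e\<in>J. \<omega> e) \<in> borel_measurable (weights I)"
  by (intro borel_measurable_sum component_measurable) auto

lemma nn_integral_prod_weights:
  fixes f :: "real \<Rightarrow> ennreal"
  assumes "finite J" "J \<subseteq> I" and f: "f \<in> borel_measurable borel"
  shows "(\<integral>\<^sup>+\<omega>. (\<Prod>e\<in>J. f (\<omega> e)) \<partial>weights I) = (\<integral>\<^sup>+x. f x \<partial>\<mu>) ^ card J"
proof -
  interpret product_prob_space "\<lambda>_. \<mu>" I
    by unfold_locales
  have f\<mu>: "f \<in> borel_measurable \<mu>"
    using measurable_compose[OF id_measurable f] by simp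
  have meas: "(\<lambda>\<omega>. \<Prod>e\<in>J. f (\<omega> e)) \<in> borel_measurable (weights J)"
    using f\<mu> by (intro borel_measurable_prod_ennreal measurable_compose[OF measurable_component_singleton]) auto
  have "(\<integral>\<^sup>+\<omega>. (\<Prod>e\<in>J. f (\<omega> e)) \<partial>weights I) = (\<integral>\<^sup>+\<omega>. (\<Prod>e\<in>J. f (restrict \<omega> J e)) \<partial>weights I)"
    by (intro nn_integral_cong prod.cong) auto
  also have "\<dots> = (\<integral>\<^sup>+\<omega>. (\<Prod>e\<in>J. f (\<omega> e)) \<partial>distr (weights I) (weights J) (\<lambda>\<omega>. restrict \<omega> J))"
    using assms(2) meas by (intro nn_integral_distr[symmetric] measurable_restrict_subset) auto
  also have "\<dots> = (\<integral>\<^sup>+\<omega>. (\<Prod>e\<in>J. f (\<omega> e)) \<partial>weights J)"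
    using distr_PiM_restrict_finite[OF assms(1,2)] by simp
  also have "\<dots> = (\<Prod>e\<in>J. \<integral>\<^sup>+x. f x \<partial>\<mu>)"
    using f\<mu> by (intro product_nn_integral_prod[OF assms(1)]) auto
  finally show ?thesis by simp
qed

text \<open>One statement serves for both tails: positive \<open>c\<close> bounds the probability that a sum is large,
  negative \<open>c\<close> the probability that it is small.\<close>
lemma chernoff_bound:
  assumes "finite J" "J \<subseteq> I"
  shows "{\<omega> \<in> space (weights I). real (card J) * t \<le> c * (\<Sum>e\<in>J. \<omega> e)} \<in> sets (weights I)"
    and "emeasure (weights I) {\<omega> \<in> space (weights I). real (card J) * t \<le> c * (\<Sum>e\<in>J. \<omega> e)}
      \<le> (ennreal (exp (- t)) * (\<integral>\<^sup>+x. ennreal (exp (c * x)) \<partial>\<mu>)) ^ card J"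
proof -
  let ?A = "{\<omega> \<in> space (weights I). real (card J) * t \<le> c * (\<Sum>e\<in>J. \<omega> e)}"
  note sum_measurable[OF assms(2), measurable]
  show A: "?A \<in> sets (weights I)" by measurable
  define f where "f = (\<lambda>x. ennreal (exp (c * x - t)))"
  have f: "f \<in> borel_measurable borel" unfolding f_def by measurable
  have "emeasure (weights I) ?A = (\<integral>\<^sup>+\<omega>. indicator ?A \<omega> \<partial>weights I)" using A by simp
  also have "\<dots> \<le> (\<integral>\<^sup>+\<omega>. (\<Prod>e\<in>J. f (\<omega> e)) \<partial>weights I)"
  proof (rule nn_integral_mono)
    fix \<omega>
    have "(\<Prod>e\<in>J. f (\<omega> e)) = ennreal (exp (\<Sum>e\<in>J. c * \<omega> e - t))"
      using assms(1) by (simp add: f_def prod_ennreal exp_sum)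
    also have "(\<Sum>e\<in>J. c * \<omega> e - t) = c * (\<Sum>e\<in>J. \<omega> e) - real (card J) * t"
      by (simp add: sum_subtractf sum_distrib_left)
    finally have "(\<Prod>e\<in>J. f (\<omega> e)) = ennreal (exp (c * (\<Sum>e\<in>J. \<omega> e) - real (card J) * t))" .
    then show "indicator ?A \<omega> \<le> (\<Prod>e\<in>J. f (\<omega> e))" by (auto split: split_indicator)
  qed
  also have "\<dots> = (\<integral>\<^sup>+x. f x \<partial>\<mu>) ^ card J" by (rule nn_integral_prod_weights[OF assms f])
  also have "(\<integral>\<^sup>+x. f x \<partial>\<mu>) = (\<integral>\<^sup>+x. ennreal (exp (- t)) * ennreal (exp (c * x)) \<partial>\<mu>)"
    by (intro nn_integral_cong) (simp add: f_def ennreal_mult[symmetric] exp_add[symmetric])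
  also have "\<dots> = ennreal (exp (- t)) * (\<integral>\<^sup>+x. ennreal (exp (c * x)) \<partial>\<mu>)"
    by (rule nn_integral_cmult) measurable
  finally show "emeasure (weights I) ?A \<le> (ennreal (exp (- t)) * (\<integral>\<^sup>+x. ennreal (exp (c * x)) \<partial>\<mu>)) ^ card J" .
qed

lemma AE_pos: "AE x in \<mu>. 0 < x"
  using diffuse[of 0] by (rule AE_mp) (rule AE_I2, use nonneg_space in force)

text \<open>As \<open>b\<close> tends to infinity, the Laplace transform tends to the probability of the value 0, which
  vanishes because there are no atoms.\<close>
lemma laplace_transform_small:
  assumes "0 < q"
  obtains b where "0 < b" "(\<integral>\<^sup>+x. ennreal (exp (- b * x)) \<partial>\<mu>) < ennreal q"
proof -
  have "(\<lambda>i. \<integral>\<^sup>+x. ennreal (exp (- real i * x)) \<partial>\<mu>) \<longlonglongrightarrow> (\<integral>\<^sup>+x. 0 \<partial>\<mu>)"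
  proof (rule nn_integral_dominated_convergence[where w = "\<lambda>_. 1"])
    show "AE x in \<mu>. ennreal (exp (- real i * x)) \<le> 1" for i
      using nonneg_space by (intro AE_I2) (simp flip: ennreal_1)
    show "AE x in \<mu>. (\<lambda>i. ennreal (exp (- real i * x))) \<longlonglongrightarrow> 0"
      using AE_pos
    proof eventually_elim
      case (elim x)
      have "(\<lambda>i. exp (- real i * x)) \<longlonglongrightarrow> 0" using elim by real_asymp
      then show ?case using tendsto_ennrealI by fastforce
    qed
  qed (auto simp: emeasure_space_1)
  then have "(\<lambda>i. \<integral>\<^sup>+x. ennreal (exp (- real i * x)) \<partial>\<mu>) \<longlonglongrightarrow> 0" by simp
  then have "\<forall>\<^sub>F i in sequentially. (\<integral>\<^sup>+x. ennreal (exp (- real i * x)) \<partial>\<mu>) < ennreal q"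
    by (rule order_tendstoD) (use assms in simp)
  then have "\<forall>\<^sub>F i in sequentially. 0 < i \<and> (\<integral>\<^sup>+x. ennreal (exp (- real i * x)) \<partial>\<mu>) < ennreal q"
    using eventually_gt_at_top[of "0::nat"] by eventually_elim simp
  then obtain i where "0 < i" "(\<integral>\<^sup>+x. ennreal (exp (- real i * x)) \<partial>\<mu>) < ennreal q"
    using eventually_happens[of _ sequentially] by auto
  then show thesis by (intro that[of "real i"]) auto
qed

text \<open>Once all weights other than that of \<open>e\<close> are given, equality of the sums prescribes the value of
  the weight of \<open>e\<close>. As there are no atoms, this has probability 0, and Fubini's theorem applies.\<close>
lemma AE_sum_neq:
  assumes J: "J \<subseteq> I" "finite J" "J' \<subseteq> I" "e \<in> J" "e \<notin> J'"
  shows "AE \<omega> in weights I. (\<Sum>e\<in>J. \<omega> e) \<noteq> (\<Sum>e\<in>J'. \<omega> e)"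
proof -
  define I' where "I' = I - {e}"
  have I: "I = insert e I'" "e \<notin> I'" using J by (auto simp: I'_def)
  interpret P': prob_space "weights I'" by (rule prob_space_weights)
  interpret pair_sigma_finite \<mu> "weights I'" ..
  note J_meas = sum_measurable[OF J(1)] sum_measurable[OF J(3)]
  have set: "{\<omega> \<in> space (weights I). (\<Sum>e\<in>J. \<omega> e) \<noteq> (\<Sum>e\<in>J'. \<omega> e)} \<in> sets (weights I)"
    by (rule borel_measurable_neq[OF J_meas])
  have upd: "(\<lambda>(x, X). X(e := x)) \<in> measurable (\<mu> \<Otimes>\<^sub>M weights I') (weights I)"
    unfolding I(1) by measurable
  have distr: "distr (\<mu> \<Otimes>\<^sub>M weights I') (weights I) (\<lambda>(x, X). X(e := x)) = weights I"
    unfolding I(1) by (intro distr_pair_PiM_eq_PiM prob_space_axioms)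
  have Q: "{z \<in> space (\<mu> \<Otimes>\<^sub>M weights I'). ((\<Sum>i\<in>J. ((\<lambda>(x, X). X(e := x)) z) i) \<noteq> (\<Sum>i\<in>J'. ((\<lambda>(x, X). X(e := x)) z) i))}
      \<in> sets (\<mu> \<Otimes>\<^sub>M weights I')"
    by (rule borel_measurable_neq[OF measurable_compose[OF upd J_meas(1)] measurable_compose[OF upd J_meas(2)]])
  have "AE X in weights I'. AE x in \<mu>. (\<Sum>i\<in>J. (X(e := x)) i) \<noteq> (\<Sum>i\<in>J'. (X(e := x)) i)"
  proof (rule AE_I2)
    fix X
    have 1: "(\<Sum>i\<in>J. (X(e := x)) i) = x + (\<Sum>i\<in>J - {e}. X i)" for x :: real
      using J by (simp add: sum.remove[of J e])
    have 2: "(\<Sum>i\<in>J'. (X(e := x)) i) = (\<Sum>i\<in>J'. X i)" for x :: real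
      using J by (intro sum.cong) auto
    show "AE x in \<mu>. (\<Sum>i\<in>J. (X(e := x)) i) \<noteq> (\<Sum>i\<in>J'. (X(e := x)) i)"
      using diffuse[of "(\<Sum>i\<in>J'. X i) - (\<Sum>i\<in>J - {e}. X i)"] unfolding 1 2
      by eventually_elim linarith
  qed
  then have "AE x in \<mu>. AE X in weights I'. (\<Sum>i\<in>J. (X(e := x)) i) \<noteq> (\<Sum>i\<in>J'. (X(e := x)) i)"
    by (subst AE_commute) (use Q in \<open>simp add: case_prod_beta\<close>)
  then have "AE z in \<mu> \<Otimes>\<^sub>M weights I'. (\<Sum>i\<in>J. ((\<lambda>(x, X). X(e := x)) z) i) \<noteq> (\<Sum>i\<in>J'. ((\<lambda>(x, X). X(e := x)) z) i)"
    using Q by (intro AE_pair_measure) auto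
  then have "AE \<omega> in distr (\<mu> \<Otimes>\<^sub>M weights I') (weights I) (\<lambda>(x, X). X(e := x)).
      (\<Sum>e\<in>J. \<omega> e) \<noteq> (\<Sum>e\<in>J'. \<omega> e)"
    by (subst AE_distr_iff[OF upd set])
  then show ?thesis by (simp only: distr)
qed

end

text \<open>A union bound over families of exponential growth, followed by the Borel--Cantelli lemma.\<close>
lemma (in prob_space) borel_cantelli_finite_families:
  fixes F :: "nat \<Rightarrow> 'i set" and bad :: "nat \<Rightarrow> 'i \<Rightarrow> 'a set" and q :: real
  assumes fin: "\<And>n. finite (F n)" and card: "\<And>n. card (F n) \<le> Q ^ n"
    and sets: "\<And>n i. i \<in> F n \<Longrightarrow> bad n i \<in> events"
    and small: "\<And>n i. i \<in> F n \<Longrightarrow> emeasure M (bad n i) \<le> ennreal q ^ n"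
    and q: "0 \<le> q" "real Q * q \<le> 1 / 2"
  shows "AE \<omega> in M. \<exists>N. \<forall>n\<ge>N. \<forall>i\<in>F n. \<omega> \<notin> bad n i"
proof -
  define A where "A n = (\<Union>i\<in>F n. bad n i)" for n
  have A: "A n \<in> events" for n unfolding A_def using fin sets by auto
  have "prob (A n) \<le> (1 / 2) ^ n" for n
  proof -
    have "prob (A n) \<le> (\<Sum>i\<in>F n. prob (bad n i))"
      unfolding A_def using fin sets by (intro measure_UNION_le)
    also have "\<dots> \<le> (\<Sum>i\<in>F n. q ^ n)"
    proof (rule sum_mono)
      fix i assume "i \<in> F n"
      then show "prob (bad n i) \<le> q ^ n"
        using small[of i n] q(1) by (simp add: emeasure_eq_measure ennreal_power)
    qed
    also have "\<dots> \<le> real Q ^ n * q ^ n"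
      using q(1) card[of n] by (simp add: mult_right_mono flip: of_nat_power)
    also have "\<dots> = (real Q * q) ^ n" by (simp add: power_mult_distrib)
    also have "\<dots> \<le> (1 / 2) ^ n" using q by (intro power_mono) auto
    finally show ?thesis .
  qed
  then have "summable (\<lambda>n. prob (A n))"
    by (intro summable_comparison_test'[OF summable_geometric[of "1 / 2 :: real"]]) auto
  then have "AE \<omega> in M. eventually (\<lambda>n. \<omega> \<in> space M - A n) sequentially"
    using A by (intro borel_cantelli_AE1) (auto simp: emeasure_eq_measure)
  then show ?thesis by eventually_elim (auto simp: A_def eventually_sequentially)
qed

text \<open>The complement of the support is a union of open null sets, and countably many of them cover
  it, so the restriction does not lose mass. The Gaussian moment yields the exponential moment by the
  inequality \<open>x \<le> a x\<^sup>2 + 1 / (4 a)\<close>.\<close>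
lemma edge_weight_restrict:
  assumes "admissible_weight_distribution \<rho>"
  shows "edge_weight (restrict_space \<rho> {0..})"
proof -
  let ?\<mu> = "restrict_space \<rho> {0..}"
  from assms obtain a where \<rho>: "prob_space \<rho>" "sets \<rho> = sets borel" "measure_support \<rho> \<subseteq> {0..}"
      "\<And>x. emeasure \<rho> {x} = 0" and a: "a > 0" "(\<integral>\<^sup>+ x. ennreal (exp (a * x\<^sup>2)) \<partial>\<rho>) < \<infinity>"
    by (auto simp: admissible_weight_distribution_def)
  interpret \<rho>: prob_space \<rho> by fact
  note [measurable_cong] = \<rho>(2)
  have space: "space \<rho> = UNIV" using sets_eq_imp_space_eq[OF \<rho>(2)] by simp
  have "AE x in \<rho>. x \<in> {0..}"
  proof -
    define \<U> where "\<U> = {U. open U \<and> emeasure \<rho> U = 0}"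
    obtain \<V> where \<V>: "\<V> \<subseteq> \<U>" "countable \<V>" "\<Union>\<V> = \<Union>\<U>"
      using Lindelof[of \<U>] unfolding \<U>_def by blast
    have "\<Union>\<V> \<in> null_sets \<rho>"
    proof (rule null_sets_UN'[OF \<V>(2), of "\<lambda>U. U", simplified])
      show "U \<in> null_sets \<rho>" if "U \<in> \<V>" for U
        using that \<V>(1) \<rho>(2) by (auto simp: \<U>_def null_sets_def)
    qed
    moreover have "{x \<in> space \<rho>. x \<notin> {0..}} \<subseteq> \<Union>\<V>"
      using \<rho>(3) unfolding \<V>(3) by (force simp: measure_support_def \<U>_def)
    ultimately show ?thesis by (rule AE_I')
  qed
  then have AE0: "AE x in \<rho>. 0 \<le> x" by simp
  then have "emeasure \<rho> ({0..} \<inter> space \<rho>) = 1"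
    using \<rho>.emeasure_eq_1_AE[of "{0..}"] \<rho>(2) by (simp add: space)
  show ?thesis
  proof (intro edge_weight.intro edge_weight_axioms.intro)
    show "prob_space ?\<mu>"
      using \<open>emeasure \<rho> ({0..} \<inter> space \<rho>) = 1\<close> \<rho>(2) by (intro prob_space_restrict_space) (auto simp: space)
    show "(\<lambda>x. x) \<in> borel_measurable ?\<mu>"
      by (intro measurable_restrict_space1) measurable
    show "0 \<le> x" if "x \<in> space ?\<mu>" for x using that by (simp add: space_restrict_space)
    show "AE x in ?\<mu>. x \<noteq> c" for c
    proof -
      have "AE x in \<rho>. x \<noteq> c"
        using \<rho>(2,4) by (intro AE_I'[of "{c}"]) (auto simp: null_sets_def)
      then show ?thesis using \<rho>(2) by (subst AE_restrict_space_iff) (auto simp: space)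
    qed
    show "(\<integral>\<^sup>+ x. ennreal (exp x) \<partial>?\<mu>) < \<infinity>"
    proof -
      have "(\<integral>\<^sup>+ x. ennreal (exp x) \<partial>?\<mu>) \<le> (\<integral>\<^sup>+ x. ennreal (exp x) \<partial>\<rho>)"
        using \<rho>(2) by (subst nn_integral_restrict_space) (auto simp: space intro!: nn_integral_mono split: split_indicator)
      also have "\<dots> \<le> (\<integral>\<^sup>+ x. ennreal (exp (1 / (4 * a))) * ennreal (exp (a * x\<^sup>2)) \<partial>\<rho>)"
      proof (rule nn_integral_mono)
        fix x :: real
        have "0 \<le> a * (x - 1 / (2 * a))\<^sup>2" using a(1) by simp
        also have "\<dots> = 1 / (4 * a) + a * x\<^sup>2 - x" using a(1) by (simp add: power2_eq_square field_simps)
        finally show "ennreal (exp x) \<le> ennreal (exp (1 / (4 * a))) * ennreal (exp (a * x\<^sup>2))"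
          by (simp flip: ennreal_mult exp_add)
      qed
      also have "\<dots> = ennreal (exp (1 / (4 * a))) * (\<integral>\<^sup>+ x. ennreal (exp (a * x\<^sup>2)) \<partial>\<rho>)"
        by (rule nn_integral_cmult) measurable
      also have "\<dots> < \<infinity>" using a(2) by (simp add: ennreal_mult_less_top)
      finally show ?thesis .
    qed
  qed
qed

section \<open>Random weights are regular\<close>

lemma fpp_length_simple:
  "distinct \<gamma> \<Longrightarrow> fpp_length \<omega> \<gamma> = (\<Sum>e\<in>set (path_edges \<gamma>). \<omega> e)"
  by (simp add: fpp_length_def sum_list_distinct_conv_sum_set distinct_path_edges)

lemma card_path_edges: "distinct \<gamma> \<Longrightarrow> card (set (path_edges \<gamma>)) = length \<gamma> - 1"
  by (simp add: distinct_card distinct_path_edges)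

context edge_weight begin

text \<open>Different simple paths from \<open>p\<close> have different edge sets, and there are only countably many of
  them.\<close>
lemma AE_simple_paths_lengths_inj:
  assumes "countable V"
  shows "AE \<omega> in weights E. \<forall>\<gamma> \<gamma>'. edge_path V E \<gamma> \<longrightarrow> edge_path V E \<gamma>' \<longrightarrow> distinct \<gamma> \<longrightarrow> distinct \<gamma>' \<longrightarrow>
      hd \<gamma> = p \<longrightarrow> hd \<gamma>' = p \<longrightarrow> fpp_length \<omega> \<gamma> = fpp_length \<omega> \<gamma>' \<longrightarrow> \<gamma> = \<gamma>'"
proof -
  define P where "P = {\<gamma> \<in> lists V. edge_path V E \<gamma> \<and> distinct \<gamma> \<and> hd \<gamma> = p}"
  have "countable P" unfolding P_def using countable_lists[OF assms] by (rule countable_Collect)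
  have "AE \<omega> in weights E. fpp_length \<omega> (fst z) = fpp_length \<omega> (snd z) \<longrightarrow> fst z = snd z"
    if "z \<in> P \<times> P" for z
  proof (cases "fst z = snd z")
    case False
    obtain \<gamma> \<gamma>' where z: "z = (\<gamma>, \<gamma>')" by (cases z)
    let ?J = "set (path_edges \<gamma>)" and ?J' = "set (path_edges \<gamma>')"
    have \<gamma>: "edge_path V E \<gamma>" "edge_path V E \<gamma>'" "distinct \<gamma>" "distinct \<gamma>'" "hd \<gamma> = hd \<gamma>'"
      using that by (auto simp: P_def z)
    then have J: "?J \<subseteq> E" "?J' \<subseteq> E" by (auto simp: edge_path_def)
    have "?J \<noteq> ?J'" using simple_path_eqI[of \<gamma> \<gamma>'] \<gamma> False by (auto simp: z edge_path_def)
    then consider e where "e \<in> ?J" "e \<notin> ?J'" | e where "e \<in> ?J'" "e \<notin> ?J" by blast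
    then have "AE \<omega> in weights E. (\<Sum>e\<in>?J. \<omega> e) \<noteq> (\<Sum>e\<in>?J'. \<omega> e)"
    proof cases
      case 1
      then show ?thesis using J by (intro AE_sum_neq) auto
    next
      case 2
      then have "AE \<omega> in weights E. (\<Sum>e\<in>?J'. \<omega> e) \<noteq> (\<Sum>e\<in>?J. \<omega> e)"
        using J by (intro AE_sum_neq) auto
      then show ?thesis by eventually_elim simp
    qed
    then show ?thesis by eventually_elim (use \<gamma> in \<open>simp add: z fpp_length_simple\<close>)
  qed simp
  then have "AE \<omega> in weights E. \<forall>z\<in>P \<times> P. fpp_length \<omega> (fst z) = fpp_length \<omega> (snd z) \<longrightarrow> fst z = snd z"
    using \<open>countable P\<close> by (subst AE_ball_countable) auto
  then show ?thesis
  proof eventually_elim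
    case (elim \<omega>)
    show ?case
    proof (intro allI impI)
      fix \<gamma> \<gamma>'
      assume *: "edge_path V E \<gamma>" "edge_path V E \<gamma>'" "distinct \<gamma>" "distinct \<gamma>'" "hd \<gamma> = p" "hd \<gamma>' = p"
        "fpp_length \<omega> \<gamma> = fpp_length \<omega> \<gamma>'"
      then have "(\<gamma>, \<gamma>') \<in> P \<times> P" by (auto simp: P_def edge_path_def)
      from elim[rule_format, OF this] show "\<gamma> = \<gamma>'" using * by simp
    qed
  qed
qed

lemma AE_weights_pos:
  assumes "countable I"
  shows "AE \<omega> in weights I. \<forall>e\<in>I. 0 < \<omega> e"
proof (subst AE_ball_countable[OF assms], rule ballI)
  show "AE \<omega> in weights I. 0 < \<omega> e" if "e \<in> I" for e
    by (rule AE_PiM_component[OF _ that AE_pos]) (rule prob_space_axioms)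
qed

text \<open>The distance to \<open>v\<close> is at most the \<open>\<omega>\<close>-length of one fixed shortest edge path. It is simple, so
  its weights are independent, and there are at most \<open>(D + 1) ^ n\<close> vertices at distance \<open>n\<close>.\<close>
lemma AE_linear_upper_bound:
  assumes "bounded_degree_graph V E D" "w \<in> V"
  obtains K where "0 \<le> K"
    "AE \<omega> in weights E. (\<forall>e\<in>E. 0 \<le> \<omega> e) \<longrightarrow>
      (\<exists>N. \<forall>v\<in>V. real N \<le> graph_dist V E w v \<longrightarrow> fpp_dist V E \<omega> w v \<le> K * graph_dist V E w v)"
proof -
  interpret bounded_degree_graph V E D by fact
  interpret W: prob_space "weights E" by (rule prob_space_weights)
  define m where "m = enn2real (\<integral>\<^sup>+ x. ennreal (exp x) \<partial>\<mu>)"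
  have m: "(\<integral>\<^sup>+ x. ennreal (exp x) \<partial>\<mu>) = ennreal m"
    unfolding m_def using exp_moment by (simp add: less_top)
  have "1 = (\<integral>\<^sup>+ x. 1 \<partial>\<mu>)" by (simp add: emeasure_space_1)
  also have "\<dots> \<le> (\<integral>\<^sup>+ x. ennreal (exp x) \<partial>\<mu>)"
    using nonneg_space by (intro nn_integral_mono) (simp flip: ennreal_1)
  finally have "1 \<le> m" unfolding m by simp
  \<comment> \<open>This makes \<open>(D + 1) exp (- K) m\<close>, the growth rate times the Chernoff rate, equal to 1/2.\<close>
  define K where "K = ln (2 * (real D + 1) * m)"
  have "1 \<le> 2 * (real D + 1) * m" using \<open>1 \<le> m\<close> mult_mono[of 1 "2 * (real D + 1)" 1 m] by simp
  then have K: "0 \<le> K" "exp (- K) = 1 / (2 * (real D + 1) * m)" by (simp_all add: K_def exp_minus divide_inverse)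
  define F where "F n = {v \<in> V. graph_dist V E w v = real n}" for n
  have "\<exists>\<gamma>. \<gamma> \<in> edge_paths_between V E w v \<and> distinct \<gamma> \<and> real (length \<gamma> - 1) = graph_dist V E w v"
    if "v \<in> V" for v
  proof -
    obtain \<gamma> where \<gamma>: "\<gamma> \<in> edge_paths_between V E w v" "real (length \<gamma> - 1) = graph_dist V E w v"
      using graph_dist_attained[OF assms(2) \<open>v \<in> V\<close>] .
    then have "is_fpp_geodesic V E (\<lambda>_. 1) w v \<gamma>"
      using assms(2) \<open>v \<in> V\<close> by (simp add: is_fpp_geodesic_def fpp_length_const_1 graph_dist_eq_fpp_dist)
    then show ?thesis using unit.geodesic_distinct[of w v \<gamma>] \<gamma> by auto
  qed
  then obtain \<gamma> where \<gamma>: "\<And>v. v \<in> V \<Longrightarrow> \<gamma> v \<in> edge_paths_between V E w v \<and> distinct (\<gamma> v) \<and>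
      real (length (\<gamma> v) - 1) = graph_dist V E w v"
    by metis
  define J where "J v = set (path_edges (\<gamma> v))" for v
  define bad where "bad n v = {\<omega> \<in> space (weights E). real (card (J v)) * K \<le> 1 * (\<Sum>e\<in>J v. \<omega> e)}" for n :: nat and v
  have J: "finite (J v)" "J v \<subseteq> E" if "v \<in> V" for v
    using \<gamma>[OF that] by (auto simp: J_def edge_paths_between_def edge_path_def)
  have cardJ: "card (J v) = n" if "v \<in> F n" for v n
  proof -
    have "real (length (\<gamma> v) - 1) = real n" "distinct (\<gamma> v)" using \<gamma>[of v] that by (auto simp: F_def)
    then show ?thesis by (simp add: J_def card_path_edges)
  qed
  have "AE \<omega> in weights E. \<exists>N. \<forall>n\<ge>N. \<forall>v\<in>F n. \<omega> \<notin> bad n v"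
  proof (rule W.borel_cantelli_finite_families)
    fix n
    have sub: "F n \<subseteq> {v \<in> V. graph_dist V E w v \<le> real n}" by (auto simp: F_def)
    show "finite (F n)" by (rule finite_subset[OF sub finite_card_ball(1)[OF assms(2)]])
    show "card (F n) \<le> (D + 1) ^ n"
      by (rule order_trans[OF card_mono[OF finite_card_ball(1)[OF assms(2)] sub] finite_card_ball(2)[OF assms(2)]])
    fix v assume v: "v \<in> F n"
    then have "v \<in> V" by (simp add: F_def)
    show "bad n v \<in> W.events" unfolding bad_def by (rule chernoff_bound(1)[OF J[OF \<open>v \<in> V\<close>]])
    show "emeasure (weights E) (bad n v) \<le> ennreal (exp (- K) * m) ^ n"
      using chernoff_bound(2)[OF J[OF \<open>v \<in> V\<close>], of K 1] \<open>1 \<le> m\<close>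
      by (simp add: bad_def cardJ[OF v] m ennreal_mult)
  next
    show "0 \<le> exp (- K) * m" using \<open>1 \<le> m\<close> by simp
    show "real (D + 1) * (exp (- K) * m) \<le> 1 / 2" unfolding K(2) using \<open>1 \<le> m\<close> by (simp add: field_simps)
  qed
  then have "AE \<omega> in weights E. (\<forall>e\<in>E. 0 \<le> \<omega> e) \<longrightarrow>
      (\<exists>N. \<forall>v\<in>V. real N \<le> graph_dist V E w v \<longrightarrow> fpp_dist V E \<omega> w v \<le> K * graph_dist V E w v)"
    using AE_space
  proof eventually_elim
    case (elim \<omega>)
    then obtain N where N: "\<forall>n\<ge>N. \<forall>v\<in>F n. \<omega> \<notin> bad n v" by blast
    have "fpp_dist V E \<omega> w v \<le> K * graph_dist V E w v"
      if nonneg: "\<forall>e\<in>E. 0 \<le> \<omega> e" and v: "v \<in> V" "real N \<le> graph_dist V E w v" for v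
    proof -
      interpret weighted_graph V E \<omega> by unfold_locales (use nonneg in blast)
      define n where "n = length (\<gamma> v) - 1"
      have n: "graph_dist V E w v = real n" using \<gamma>[OF v(1)] by (simp add: n_def)
      then have F: "v \<in> F n" "N \<le> n" using v by (auto simp: F_def)
      have good: "\<omega> \<notin> bad n v" using N F by blast
      have "fpp_dist V E \<omega> w v \<le> fpp_length \<omega> (\<gamma> v)" using \<gamma>[OF v(1)] by (intro dist_le_length) simp
      also have "\<dots> = (\<Sum>e\<in>J v. \<omega> e)" using \<gamma>[OF v(1)] by (simp add: J_def fpp_length_simple)
      also have "\<dots> \<le> K * real n"
        using good elim(2) cardJ[OF F(1)] by (simp add: bad_def mult.commute)
      finally show ?thesis by (simp add: n)
    qed
    then show ?case by blast
  qed
  then show thesis using K(1) by (rule that[rotated])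
qed

text \<open>There are at most \<open>(D + 1) ^ n\<close> starting points and for each of them at most \<open>D ^ n\<close> paths with
  \<open>n\<close> edges. The Chernoff bound with exponent \<open>- b\<close> and threshold \<open>n / b\<close> has rate \<open>e\<close> times the Laplace
  transform at \<open>b\<close>, which beats this number for large \<open>b\<close>.\<close>
lemma AE_linear_lower_bound:
  fixes V :: "'v set"
  assumes "bounded_degree_graph V E D" "w \<in> V"
  obtains \<epsilon> where "0 < \<epsilon>"
    "AE \<omega> in weights E. \<exists>N. \<forall>\<gamma>. edge_path V E \<gamma> \<longrightarrow> distinct \<gamma> \<longrightarrow> N \<le> length \<gamma> - 1 \<longrightarrow>
      graph_dist V E w (hd \<gamma>) \<le> real (length \<gamma> - 1) \<longrightarrow> \<epsilon> * real (length \<gamma> - 1) \<le> fpp_length \<omega> \<gamma>"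
proof -
  interpret bounded_degree_graph V E D by fact
  interpret W: prob_space "weights E" by (rule prob_space_weights)
  define Q where "Q = (D + 1) ^ 2"
  have "Q > 0" by (simp add: Q_def)
  \<comment> \<open>chosen such that \<open>Q e q = 1/2\<close>\<close>
  define q where "q = 1 / (2 * real Q * exp 1)"
  have "0 < q" using \<open>Q > 0\<close> by (simp add: q_def)
  then obtain b where b: "0 < b" "(\<integral>\<^sup>+x. ennreal (exp (- b * x)) \<partial>\<mu>) < ennreal q"
    by (rule laplace_transform_small)
  define F where "F n = (\<Union>u\<in>{u \<in> V. graph_dist V E w u \<le> real n}. {\<gamma> \<in> walks n u. distinct \<gamma>})" for n
  define J where "J \<gamma> = set (path_edges \<gamma>)" for \<gamma> :: "'v list"
  define bad where "bad n \<gamma> = {\<omega> \<in> space (weights E). real (card (J \<gamma>)) * - 1 \<le> - b * (\<Sum>e\<in>J \<gamma>. \<omega> e)}" for n :: nat and \<gamma>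
  have F: "edge_path V E \<gamma>" "distinct \<gamma>" "card (J \<gamma>) = n" if "\<gamma> \<in> F n" for n \<gamma>
    using that by (auto simp: F_def walks_def J_def card_path_edges)
  have J: "finite (J \<gamma>)" "J \<gamma> \<subseteq> E" if "\<gamma> \<in> F n" for n \<gamma>
    using F(1)[OF that] by (auto simp: J_def edge_path_def)
  have "AE \<omega> in weights E. \<exists>N. \<forall>n\<ge>N. \<forall>\<gamma>\<in>F n. \<omega> \<notin> bad n \<gamma>"
  proof (rule W.borel_cantelli_finite_families)
    fix n
    note ball = finite_card_ball[OF assms(2), of n]
    have walks: "finite {\<gamma> \<in> walks n u. distinct \<gamma>}" "card {\<gamma> \<in> walks n u. distinct \<gamma>} \<le> (D + 1) ^ n" if "u \<in> V" for u
    proof -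
      note w = finite_card_walks[OF that, of n]
      then show "finite {\<gamma> \<in> walks n u. distinct \<gamma>}" by simp
      have "card {\<gamma> \<in> walks n u. distinct \<gamma>} \<le> card (walks n u)" using w by (intro card_mono) auto
      also have "\<dots> \<le> D ^ n" using w by simp
      also have "\<dots> \<le> (D + 1) ^ n" by (intro power_mono) auto
      finally show "card {\<gamma> \<in> walks n u. distinct \<gamma>} \<le> (D + 1) ^ n" .
    qed
    show "finite (F n)" unfolding F_def using ball(1) walks(1) by auto
    have "card (F n) \<le> (\<Sum>u\<in>{u \<in> V. graph_dist V E w u \<le> real n}. card {\<gamma> \<in> walks n u. distinct \<gamma>})"
      unfolding F_def by (rule card_UN_le[OF ball(1)])
    also have "\<dots> \<le> (\<Sum>u\<in>{u \<in> V. graph_dist V E w u \<le> real n}. (D + 1) ^ n)"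
      using walks(2) by (intro sum_mono) auto
    also have "\<dots> = card {u \<in> V. graph_dist V E w u \<le> real n} * (D + 1) ^ n" by simp
    also have "\<dots> \<le> (D + 1) ^ n * (D + 1) ^ n" by (rule mult_le_mono1[OF ball(2)])
    also have "\<dots> = Q ^ n" unfolding Q_def power2_eq_square power_mult_distrib ..
    finally show "card (F n) \<le> Q ^ n" .
    fix \<gamma> assume \<gamma>: "\<gamma> \<in> F n"
    show "bad n \<gamma> \<in> W.events" unfolding bad_def by (rule chernoff_bound(1)[OF J[OF \<gamma>]])
    have "emeasure (weights E) (bad n \<gamma>) \<le>
        (ennreal (exp (- (- 1))) * (\<integral>\<^sup>+x. ennreal (exp (- b * x)) \<partial>\<mu>)) ^ card (J \<gamma>)"
      unfolding bad_def by (rule chernoff_bound(2)[OF J[OF \<gamma>]])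
    also have "\<dots> \<le> (ennreal (exp 1) * ennreal q) ^ card (J \<gamma>)"
      using b(2) by (intro power_mono mult_mono) auto
    also have "\<dots> = ennreal (exp 1 * q) ^ n" using \<open>0 < q\<close> by (simp add: F(3)[OF \<gamma>] ennreal_mult)
    finally show "emeasure (weights E) (bad n \<gamma>) \<le> ennreal (exp 1 * q) ^ n" .
  next
    show "0 \<le> exp 1 * q" using \<open>0 < q\<close> by simp
    show "real Q * (exp 1 * q) \<le> 1 / 2" using \<open>Q > 0\<close> by (simp add: q_def field_simps)
  qed
  then have "AE \<omega> in weights E. \<exists>N. \<forall>\<gamma>. edge_path V E \<gamma> \<longrightarrow> distinct \<gamma> \<longrightarrow> N \<le> length \<gamma> - 1 \<longrightarrow>
      graph_dist V E w (hd \<gamma>) \<le> real (length \<gamma> - 1) \<longrightarrow> 1 / b * real (length \<gamma> - 1) \<le> fpp_length \<omega> \<gamma>"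
    using AE_space
  proof eventually_elim
    case (elim \<omega>)
    then obtain N where N: "\<forall>n\<ge>N. \<forall>\<gamma>\<in>F n. \<omega> \<notin> bad n \<gamma>" by blast
    have "1 / b * real (length \<gamma> - 1) \<le> fpp_length \<omega> \<gamma>"
      if \<gamma>: "edge_path V E \<gamma>" "distinct \<gamma>" "N \<le> length \<gamma> - 1"
        "graph_dist V E w (hd \<gamma>) \<le> real (length \<gamma> - 1)" for \<gamma>
    proof -
      define n where "n = length \<gamma> - 1"
      have "hd \<gamma> \<in> V" "length \<gamma> = Suc n" using \<gamma>(1) by (cases \<gamma>; auto simp: edge_path_def n_def)+
      then have "\<gamma> \<in> F n" using \<gamma> by (auto simp: F_def walks_def n_def)
      then have "\<omega> \<notin> bad n \<gamma>" using N \<gamma>(3) unfolding n_def by blast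
      then have "real n < b * (\<Sum>e\<in>J \<gamma>. \<omega> e)"
        using elim(2) F(3)[OF \<open>\<gamma> \<in> F n\<close>] by (simp add: bad_def)
      then show ?thesis using b(1) \<gamma>(2) by (simp add: J_def fpp_length_simple field_simps n_def)
    qed
    then show ?case by blast
  qed
  then show thesis using b(1) by (intro that[of "1 / b"]) auto
qed

lemma AE_regular_weights:
  assumes "hyperbolic_graph V E w \<delta>" "bounded_degree_graph V E D" "p \<in> V"
  obtains K \<epsilon> where "AE \<omega> in weights E. \<exists>N. regular_weights V E w \<delta> D \<omega> p K \<epsilon> N"
proof -
  interpret hyperbolic_graph V E w \<delta> by fact
  interpret bounded_degree_graph V E D by fact
  obtain K where K: "0 \<le> K" and upper:
    "AE \<omega> in weights E. (\<forall>e\<in>E. 0 \<le> \<omega> e) \<longrightarrow>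
      (\<exists>N. \<forall>v\<in>V. real N \<le> graph_dist V E w v \<longrightarrow> fpp_dist V E \<omega> w v \<le> K * graph_dist V E w v)"
    using AE_linear_upper_bound[OF assms(2) base] .
  obtain \<epsilon> where \<epsilon>: "0 < \<epsilon>" and lower:
    "AE \<omega> in weights E. \<exists>N. \<forall>\<gamma>. edge_path V E \<gamma> \<longrightarrow> distinct \<gamma> \<longrightarrow> N \<le> length \<gamma> - 1 \<longrightarrow>
      graph_dist V E w (hd \<gamma>) \<le> real (length \<gamma> - 1) \<longrightarrow> \<epsilon> * real (length \<gamma> - 1) \<le> fpp_length \<omega> \<gamma>"
    using AE_linear_lower_bound[OF assms(2) base] .
  have "AE \<omega> in weights E. \<exists>N. regular_weights V E w \<delta> D \<omega> p K \<epsilon> N"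
    using AE_weights_pos[OF countable_E] AE_simple_paths_lengths_inj[OF countable_V, of E p] upper lower
  proof eventually_elim
    case (elim \<omega>)
    have nonneg: "\<forall>e\<in>E. 0 \<le> \<omega> e" using elim(1) by (auto intro: less_imp_le)
    obtain N1 where N1: "\<forall>v\<in>V. real N1 \<le> graph_dist V E w v \<longrightarrow> fpp_dist V E \<omega> w v \<le> K * graph_dist V E w v"
      using elim(3) nonneg by blast
    obtain N2 where N2: "\<forall>\<gamma>. edge_path V E \<gamma> \<longrightarrow> distinct \<gamma> \<longrightarrow> N2 \<le> length \<gamma> - 1 \<longrightarrow>
      graph_dist V E w (hd \<gamma>) \<le> real (length \<gamma> - 1) \<longrightarrow> \<epsilon> * real (length \<gamma> - 1) \<le> fpp_length \<omega> \<gamma>"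
      using elim(4) ..
    have "regular_weights V E w \<delta> D \<omega> p K \<epsilon> (max N1 N2)"
    proof
      show "0 \<le> \<omega> e" if "e \<in> E" for e using nonneg that ..
      show "\<gamma> = \<gamma>'" if "edge_path V E \<gamma>" "edge_path V E \<gamma>'" "distinct \<gamma>" "distinct \<gamma>'" "hd \<gamma> = p"
        "hd \<gamma>' = p" "fpp_length \<omega> \<gamma> = fpp_length \<omega> \<gamma>'" for \<gamma> \<gamma>'
        by (rule elim(2)[rule_format, OF that])
      show "fpp_dist V E \<omega> w v \<le> K * d w v" if "v \<in> V" "real (max N1 N2) \<le> d w v" for v
        using N1[rule_format, OF that(1)] that(2) by simp
      show "\<epsilon> * real (length \<gamma> - 1) \<le> fpp_length \<omega> \<gamma>"
        if "edge_path V E \<gamma>" "distinct \<gamma>" "max N1 N2 \<le> length \<gamma> - 1" "d w (hd \<gamma>) \<le> real (length \<gamma> - 1)" for \<gamma>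
        by (rule N2[rule_format, OF that(1,2) _ that(4)]) (use that(3) in simp)
    qed (fact assms(3) elim(1) K \<epsilon>)+
    then show ?case ..
  qed
  then show thesis by (rule that)
qed

end

section \<open>Cayley graphs\<close>

lemma (in group) cayley_step:
  assumes "x \<in> carrier G" "s \<in> carrier G" "s \<in> S"
  shows "[x, x \<otimes> s] \<in> edge_paths_between (carrier G) (cayley_edges G S) x (x \<otimes> s)"
proof -
  have "inv x \<otimes> (x \<otimes> s) = s" using assms by (simp add: m_assoc[symmetric])
  then have "{x, x \<otimes> s} \<in> cayley_edges G S" using assms unfolding cayley_edges_def by force
  then show ?thesis using assms by (simp add: edge_paths_between_def edge_path_def)
qed

text \<open>The starting point \<open>x\<close> is arbitrary because the path for a product of two group elements
  consists of the path for the first one and the path for the second one from the end of the first.\<close>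
lemma (in group) cayley_path_mult:
  assumes S: "S \<subseteq> carrier G" "\<forall>s\<in>S. inv s \<in> S" and "g \<in> generate G S" "x \<in> carrier G"
  shows "edge_paths_between (carrier G) (cayley_edges G S) x (x \<otimes> g) \<noteq> {}"
  using assms(3,4)
proof (induction arbitrary: x rule: generate.induct)
  case one
  then show ?case using edge_paths_between_single[of x] by auto
next
  case (incl s)
  then show ?case using cayley_step[of x s S] S(1) by blast
next
  case (inv s)
  then show ?case using cayley_step[of x "inv s" S] S by blast
next
  case (eng g h)
  have gh: "g \<in> carrier G" "h \<in> carrier G" using eng generate_in_carrier[OF S(1)] by auto
  obtain \<gamma> where "\<gamma> \<in> edge_paths_between (carrier G) (cayley_edges G S) x (x \<otimes> g)"
    using eng by blast
  moreover obtain \<gamma>' where "\<gamma>' \<in> edge_paths_between (carrier G) (cayley_edges G S) (x \<otimes> g) (x \<otimes> g \<otimes> h)"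
    using eng gh by blast
  ultimately obtain \<kappa> where "\<kappa> \<in> edge_paths_between (carrier G) (cayley_edges G S) x (x \<otimes> g \<otimes> h)"
    by (rule edge_paths_between_join)
  then show ?case using eng gh by (auto simp: m_assoc)
qed

lemma (in group) cayley_neighbours:
  assumes S: "S \<subseteq> carrier G" "\<forall>s\<in>S. inv s \<in> S" and "v \<in> carrier G"
  shows "{u \<in> carrier G. {v, u} \<in> cayley_edges G S} \<subseteq> (\<lambda>s. v \<otimes> s) ` S"
proof
  fix u assume "u \<in> {u \<in> carrier G. {v, u} \<in> cayley_edges G S}"
  then have u: "u \<in> carrier G" and or: "inv v \<otimes> u \<in> S \<or> inv u \<otimes> v \<in> S"
    by (auto simp: cayley_edges_def doubleton_eq_iff)
  from or have "inv v \<otimes> u \<in> S"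
  proof
    assume "inv u \<otimes> v \<in> S"
    then have "inv (inv u \<otimes> v) \<in> S" using S(2) by blast
    then show ?thesis using u assms(3) by (simp add: inv_mult_group)
  qed
  moreover have "u = v \<otimes> (inv v \<otimes> u)" using u assms(3) by (simp add: m_assoc[symmetric])
  ultimately show "u \<in> (\<lambda>s. v \<otimes> s) ` S" by blast
qed

lemma bounded_degree_cayley_graph:
  assumes "group G" "finite_symmetric_generating_set G S"
  shows "bounded_degree_graph (carrier G) (cayley_edges G S) (card S)"
proof -
  interpret group G by fact
  have S: "finite S" "S \<subseteq> carrier G" "\<forall>s\<in>S. inv\<^bsub>G\<^esub> s \<in> S" "generate G S = carrier G"
    using assms(2) by (auto simp: finite_symmetric_generating_set_def)
  show ?thesis
  proof
    fix x y assume "x \<in> carrier G" "y \<in> carrier G"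
    then show "edge_paths_between (carrier G) (cayley_edges G S) x y \<noteq> {}"
      using cayley_path_mult[OF S(2,3), of "inv\<^bsub>G\<^esub> x \<otimes>\<^bsub>G\<^esub> y" x] S(4) by (simp add: m_assoc[symmetric])
  next
    fix e assume "e \<in> cayley_edges G S"
    then show "\<exists>u\<in>carrier G. \<exists>v\<in>carrier G. e = {u, v}" by (auto simp: cayley_edges_def)
  next
    fix v assume v: "v \<in> carrier G"
    note sub = cayley_neighbours[OF S(2,3) v]
    show "finite {u \<in> carrier G. {v, u} \<in> cayley_edges G S}" using finite_subset[OF sub] S(1) by simp
    have "card {u \<in> carrier G. {v, u} \<in> cayley_edges G S} \<le> card ((\<lambda>s. v \<otimes>\<^bsub>G\<^esub> s) ` S)"
      using S(1) by (intro card_mono[OF _ sub]) simp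
    also have "\<dots> \<le> card S" by (rule card_image_le[OF S(1)])
    finally show "card {u \<in> carrier G. {v, u} \<in> cayley_edges G S} \<le> card S" .
  qed
qed

section \<open>Convergence of geodesics to a boundary point\<close>

text \<open>A Cayley graph is connected and has bounded degree, so the random weights are almost surely
  regular, and for regular weights the convergence holds.\<close>
theorem theorem6p7:
  fixes G :: "('a, 'b) monoid_scheme" and S :: "'a set" and \<rho> :: "real measure"
    and p :: 'a and x :: "nat \<Rightarrow> 'a" and \<xi> :: "(nat \<Rightarrow> 'a) set"
  defines "V \<equiv> carrier G" and "E \<equiv> cayley_edges G S"
    and "d \<equiv> cayley_dist G S" and "w \<equiv> one G"
  assumes "group G"
    and "finite_symmetric_generating_set G S"
    and "gromov_hyperbolic V d"
    and "admissible_weight_distribution \<rho>"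
    and "p \<in> V"
    and "\<xi> \<in> gromov_boundary V d w"
    and "\<forall>n. x n \<in> V"
    and "converges_to_boundary V d w x \<xi>"
  shows "AE \<omega> in fpp_measure E \<rho>.
    \<exists>\<phi> r. strict_mono (\<phi> :: nat \<Rightarrow> nat) \<and>
      is_fpp_geodesic_ray V E \<omega> r \<and> r 0 = p \<and> has_direction V d w r \<xi> \<and>
      paths_converge_to_ray (\<lambda>n. fpp_geodesic V E \<omega> p (x (\<phi> n))) r"
proof -
  interpret group G by fact
  interpret bounded_degree_graph V E "card S"
    unfolding V_def E_def by (rule bounded_degree_cayley_graph) fact+
  have d: "d = graph_dist V E" by (simp add: d_def V_def E_def)
  have w: "w \<in> V" by (simp add: w_def V_def)
  obtain \<delta> where \<delta>: "0 \<le> \<delta>" "\<forall>w\<in>V. \<forall>x\<in>V. \<forall>y\<in>V. \<forall>z\<in>V.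
      min (gromov_product d w x y) (gromov_product d w y z) - \<delta> \<le> gromov_product d w x z"
    using assms(7) unfolding gromov_hyperbolic_def by blast
  interpret hyperbolic_graph V E w \<delta>
  proof unfold_locales
    fix x y z assume "x \<in> V" "y \<in> V" "z \<in> V"
    then show "min (gromov_product (graph_dist V E) w x y) (gromov_product (graph_dist V E) w y z) - \<delta>
        \<le> gromov_product (graph_dist V E) w x z"
      using \<delta>(2)[rule_format, OF w] unfolding d by simp
  next
    show "w \<in> V" by fact
    show "0 \<le> \<delta>" by fact
  qed
  interpret edge_weight "restrict_space \<rho> {0..}" by (rule edge_weight_restrict) fact
  obtain K \<epsilon> where "AE \<omega> in weights E. \<exists>N. regular_weights V E w \<delta> (card S) \<omega> p K \<epsilon> N"
    using AE_regular_weights[OF hyperbolic_graph_axioms bounded_degree_graph_axioms \<open>p \<in> V\<close>] .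
  then show ?thesis
    unfolding fpp_measure_def d
  proof eventually_elim
    case (elim \<omega>)
    then obtain N where "regular_weights V E w \<delta> (card S) \<omega> p K \<epsilon> N" ..
    then interpret regular_weights V E w \<delta> "card S" \<omega> p K \<epsilon> N .
    show ?case by (rule geodesics_converge_to_ray) (use assms(12) d in simp)
  qed
qed

end
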